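(* There exists (in ZFC) a separable pseudocompact space $X$ such that $B_1(X,[0,1])$ is a Choquet space, but $B_1(X)$ is not a Choquet space.
   Context: For topological spaces $X,Y$, a function $f:X\to Y$ is a Baire-one function if it is the pointwise limit of a sequence of continuous functions from $X$ to $Y$. $B_1(X,Y)$ denotes the set of all Baire-one functions from $X$ to $Y$ endowed with the topology of pointwise convergence, and $B_1(X)=B_1(X,\mathbb{R})$. The game $G(Z)$ on a topological space $Z$: player I chooses a nonempty open set $V_0\subseteq Z$, then player II chooses a nonempty open set $V_1\subseteq V_0$; at the $n$th step player I chooses a nonempty open set $V_{2n}\subseteq V_{2n-1}$ and then player II chooses a nonempty open set $V_{2n+1}\subseteq V_{2n}$. Player I wins if $\bigcap_{n\in\omega}V_n=\emptyset$; otherwise player II wins. $Z$ is a Choquet space if player II has a winning strategy in $G(Z)$. *)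

theory Defs
  imports "HOL-Analysis.Analysis"
begin

definition pseudocompact_space :: "'a topology \<Rightarrow> bool" where
  "pseudocompact_space X \<longleftrightarrow>
     (\<forall>f. continuous_map X euclideanreal f \<longrightarrow> bounded (f ` topspace X))"

text \<open>Functions on the carrier are represented by their extensional versions, so that they
  are the points of the product topology, i.e. of the topology of pointwise convergence.\<close>

definition baire_one_functions :: "'a topology \<Rightarrow> 'b topology \<Rightarrow> ('a \<Rightarrow> 'b) set" where
  "baire_one_functions X Y =
     {f \<in> topspace X \<rightarrow>\<^sub>E topspace Y.
        \<exists>F :: nat \<Rightarrow> 'a \<Rightarrow> 'b. (\<forall>n. continuous_map X Y (F n)) \<and>
          (\<forall>x \<in> topspace X. limitin Y (\<lambda>n. F n x) (f x) sequentially)}"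

definition baire_one_space :: "'a topology \<Rightarrow> 'b topology \<Rightarrow> ('a \<Rightarrow> 'b) topology" where
  "baire_one_space X Y =
     subtopology (product_topology (\<lambda>_. Y) (topspace X)) (baire_one_functions X Y)"

text \<open>A position of the game is the list of the sets chosen so far, in order. The entries with
  even index are the moves of player I, so player II is to move at the positions of odd length.\<close>

definition game_position :: "'a topology \<Rightarrow> 'a set list \<Rightarrow> bool" where
  "game_position Z p \<longleftrightarrow>
     (\<forall>i < length p. openin Z (p ! i) \<and> p ! i \<noteq> {}) \<and>
     (\<forall>i. Suc i < length p \<longrightarrow> p ! Suc i \<subseteq> p ! i)"

definition game_play :: "'a topology \<Rightarrow> (nat \<Rightarrow> 'a set) \<Rightarrow> bool" where
  "game_play Z V \<longleftrightarrow>
     (\<forall>n. openin Z (V n) \<and> V n \<noteq> {} \<and> V (Suc n) \<subseteq> V n)"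

definition strategy_II :: "'a topology \<Rightarrow> ('a set list \<Rightarrow> 'a set) \<Rightarrow> bool" where
  "strategy_II Z \<sigma> \<longleftrightarrow>
     (\<forall>p. game_position Z p \<and> odd (length p) \<longrightarrow>
        openin Z (\<sigma> p) \<and> \<sigma> p \<noteq> {} \<and> \<sigma> p \<subseteq> last p)"

definition winning_strategy_II :: "'a topology \<Rightarrow> ('a set list \<Rightarrow> 'a set) \<Rightarrow> bool" where
  "winning_strategy_II Z \<sigma> \<longleftrightarrow> strategy_II Z \<sigma> \<and>
     (\<forall>V. game_play Z V \<and> (\<forall>n. V (2 * n + 1) = \<sigma> (map V [0..<2 * n + 1])) \<longrightarrow>
        (\<Inter>n. V n) \<noteq> {})"

definition choquet_space :: "'a topology \<Rightarrow> bool" where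
  "choquet_space Z \<longleftrightarrow> (\<exists>\<sigma>. winning_strategy_II Z \<sigma>)"

end

theory Submission
  imports Defs
begin

text \<open>
  The space is a set of 0/1-valued functions on the reals, the union of a countable dense set
  \<open>D\<close> and a set \<open>E\<close>, with an ideal of ``null'' subsets of \<open>D\<close>. Three properties carry the
  proof (locale \<open>saturated_incidence\<close>). First, null sets contain no nonempty relatively open
  subset of \<open>D\<close> and the ideal is maximal in this respect. Secondly, every 0/1-pattern on
  countably many coordinates is realised by a point of \<open>E\<close>. Thirdly, every function from the union of a
  countable subset of \<open>E\<close> and a null subset of \<open>D\<close> to \<open>{0, 1}\<close> is the restriction of a
  coordinate. Such a family is built from an independent family of subsets of the natural
  numbers and a maximal ideal: redefining a coordinate on a null set changes no cylinder by more
  than a null set, and there are continuum many coordinates, enough to prescribe all values.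

  Every \<open>[0, 1]\<close>-valued function on a countable subset of the space extends to a Baire-one
  function. In fact \<open>D\<close> is irresolvable in a strong sense: a subset of \<open>D\<close> whose
  complement is dense in \<open>D\<close> is null, so that a function from \<open>D\<close> to \<open>{0, 1}\<close> is locally constant off
  a null set; on that null set and on a countable subset of \<open>E\<close> a coordinate takes over. Binary
  digits reduce \<open>[0, 1]\<close>-valued functions to this case. Player II therefore wins in the Baire-one
  functions to \<open>[0, 1]\<close> by keeping the values at finitely many points in small compact intervals:
  only countably many points are ever mentioned, and a cluster point of the play, restricted to
  them, extends.

  For real-valued functions compactness of the values is lost, and a function on \<open>D\<close> that
  tends to infinity does not extend. Since \<open>E\<close> realises all countable patterns, the space is pseudocompact and a
  Baire space, so a Baire-one function is bounded on a nonempty open set and cannot tend to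
  infinity along \<open>D\<close>. Suppose that player II had a winning strategy. Player I plays
  two games against it at once and always demands large values, in one game, at the points that
  player II has restricted in the other one. Each point of \<open>D\<close> is then given
  a large value in at least one of the games, so that the maximum of the two resulting Baire-one
  functions tends to infinity along \<open>D\<close>, a contradiction.
\<close>

section \<open>Codes and an independent family\<close>

lemma surj_real_sequence_code: "\<exists>\<Phi> :: real \<Rightarrow> nat \<Rightarrow> real. surj \<Phi>"
proof -
  obtain \<beta> :: "nat set \<Rightarrow> real" where \<beta>: "bij \<beta>"
    using nat_sets_eqpoll_reals unfolding eqpoll_def by blast
  define \<Phi> where "\<Phi> = (\<lambda>r n. \<beta> {m. prod_encode (n, m) \<in> inv \<beta> r})"
  have "\<exists>r. s = \<Phi> r" for s
  proof
    define C where "C = {l. snd (prod_decode l) \<in> inv \<beta> (s (fst (prod_decode l)))}"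
    show "s = \<Phi> (\<beta> C)"
    proof
      fix n
      have "{m. prod_encode (n, m) \<in> inv \<beta> (\<beta> C)} = inv \<beta> (s n)"
        using \<beta> by (simp add: bij_is_inj C_def)
      then show "s n = \<Phi> (\<beta> C) n"
        using \<beta> by (simp add: \<Phi>_def bij_is_surj surj_f_inv_f)
    qed
  qed
  then show ?thesis
    unfolding surj_def by blast
qed

text \<open>
  A point of \<open>E\<close> is coded by a sequence of coordinates together with the values that
  the point has to take there.
\<close>

lemma surj_point_code: "\<exists>\<psi> :: real \<Rightarrow> (nat \<Rightarrow> real) \<times> (nat \<Rightarrow> bool). surj \<psi>"
proof -
  obtain \<Phi> :: "real \<Rightarrow> nat \<Rightarrow> real" where \<Phi>: "surj \<Phi>"
    using surj_real_sequence_code by blast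
  define \<psi> :: "real \<Rightarrow> (nat \<Rightarrow> real) \<times> (nat \<Rightarrow> bool)" where "\<psi> = (\<lambda>r. (\<lambda>n. \<Phi> r (2 * n), \<lambda>n. \<Phi> r (2 * n + 1) > 0))"
  have "\<exists>r. (a, b) = \<psi> r" for a :: "nat \<Rightarrow> real" and b :: "nat \<Rightarrow> bool"
  proof -
    obtain r where r: "\<Phi> r = (\<lambda>m. if even m then a (m div 2) else of_bool (b (m div 2)))"
      using \<Phi> by (metis surjD)
    then show ?thesis
      unfolding \<psi>_def by (intro exI[of _ r]) (auto simp: fun_eq_iff)
  qed
  then have "surj \<psi>"
    unfolding surj_def by auto
  then show ?thesis by (rule exI[of _ \<psi>])
qed

text \<open>
  A coordinate is coded by a sequence of points of \<open>E\<close> with the values to be taken at them, a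
  set of indices of points of \<open>D\<close> with the values to be taken at these, and a tag. The tag
  provides uncountably many coordinates with the same data.
\<close>

lemma surj_coordinate_code:
  "\<exists>\<phi> :: real \<Rightarrow> (nat \<Rightarrow> real) \<times> (nat \<Rightarrow> bool) \<times> nat set \<times> (nat \<Rightarrow> bool) \<times> real. surj \<phi>"
proof -
  obtain \<Phi> :: "real \<Rightarrow> nat \<Rightarrow> real" where \<Phi>: "surj \<Phi>"
    using surj_real_sequence_code by blast
  define \<phi> where "\<phi> = (\<lambda>r. (\<lambda>n. \<Phi> r (prod_encode (0, n)), \<lambda>n. \<Phi> r (prod_encode (1, n)) > 0,
     {n. \<Phi> r (prod_encode (2, n)) > 0}, \<lambda>n. \<Phi> r (prod_encode (3, n)) > 0,
     \<Phi> r (prod_encode (4, 0))))"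
  have "\<exists>r. (a, b, N, c, t) = \<phi> r"
    for a :: "nat \<Rightarrow> real" and b :: "nat \<Rightarrow> bool" and N and c :: "nat \<Rightarrow> bool" and t
  proof -
    define s where "s = (\<lambda>m. case prod_decode m of (i, n) \<Rightarrow>
        if i = 0 then a n else if i = 1 then of_bool (b n) else if i = 2 then of_bool (n \<in> N)
        else if i = 3 then of_bool (c n) else t)"
    obtain r where r: "\<Phi> r = s"
      using \<Phi> by (metis surjD)
    then show ?thesis
      by (intro exI[of _ r]) (simp add: \<phi>_def s_def)
  qed
  then have "surj \<phi>"
    unfolding surj_def by (simp only: split_paired_All) blast
  then show ?thesis by (rule exI[of _ \<phi>])
qed

text \<open>
  The family is the trace on a countable dense set of the cube of dimension continuum: the
  indicator functions of finite unions of rational intervals are dense, since finitely many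
  reals can be separated by such intervals.
\<close>

lemma independent_family_on_nat:
  "\<exists>B :: nat \<Rightarrow> real \<Rightarrow> bool. \<forall>K p. finite K \<longrightarrow> (\<exists>k. \<forall>r\<in>K. B k r = p r)"
proof -
  define B :: "nat \<Rightarrow> real \<Rightarrow> bool" where
    "B = (\<lambda>k r. \<exists>(a, b) \<in> set (from_nat k :: (rat \<times> rat) list). of_rat a < r \<and> r < of_rat b)"
  have "\<exists>k. \<forall>r\<in>K. B k r = p r" if K: "finite K" for K p
  proof -
    have "\<exists>I :: rat \<times> rat. of_rat (fst I) < r \<and> r < of_rat (snd I) \<and>
            (\<forall>s\<in>K. of_rat (fst I) < s \<and> s < of_rat (snd I) \<longrightarrow> s = r)" for r
    proof -
      obtain \<delta> where \<delta>: "\<delta> > 0" "\<And>s. s \<in> K \<Longrightarrow> s \<noteq> r \<Longrightarrow> \<delta> \<le> dist r s"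
        using finite_set_avoid[OF K, of r] by blast
      obtain a where a: "r - \<delta> < of_rat a" "of_rat a < r"
        using of_rat_dense[of "r - \<delta>" r] \<delta>(1) by auto
      obtain b where b: "r < of_rat b" "of_rat b < r + \<delta>"
        using of_rat_dense[of r "r + \<delta>"] \<delta>(1) by auto
      show ?thesis
        using a b \<delta>(2) by (intro exI[of _ "(a, b)"]) (force simp: dist_real_def)
    qed
    then obtain I :: "real \<Rightarrow> rat \<times> rat" where
      I: "\<And>r. of_rat (fst (I r)) < r \<and> r < of_rat (snd (I r)) \<and>
            (\<forall>s\<in>K. of_rat (fst (I r)) < s \<and> s < of_rat (snd (I r)) \<longrightarrow> s = r)"
      by metis
    obtain l where l: "set l = I ` {r \<in> K. p r}"
      using K finite_list[of "I ` {r \<in> K. p r}"] by auto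
    have "B (to_nat l) r = p r" if "r \<in> K" for r
    proof
      assume "B (to_nat l) r"
      then obtain s where s: "s \<in> K" "p s" "of_rat (fst (I s)) < r" "r < of_rat (snd (I s))"
        using l by (auto simp: B_def)
      then have "r = s" using I[of s] \<open>r \<in> K\<close> by blast
      then show "p r" using s by simp
    next
      assume "p r"
      then have "I r \<in> set l" using l that by auto
      then show "B (to_nat l) r" using I[of r] by (force simp: B_def)
    qed
    then show ?thesis by blast
  qed
  then show ?thesis by blast
qed

text \<open>
  Zorn's lemma for ideals all of whose members satisfy a given property. If adding a set would
  spoil no member, then the set together with the ideal still generates an admissible ideal.
\<close>

lemma maximal_ideal_avoiding:
  fixes P :: "'a set \<Rightarrow> bool"
  assumes "P {}"
  shows "\<exists>\<N>. {} \<in> \<N> \<and> (\<forall>N\<in>\<N>. P N) \<and> (\<forall>M\<in>\<N>. \<forall>N\<in>\<N>. M \<union> N \<in> \<N>) \<and>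
           (\<forall>S. (\<forall>N\<in>\<N>. P (N \<union> S)) \<longrightarrow> S \<in> \<N>)"
proof -
  define \<I> where "\<I> = {\<N>. {} \<in> \<N> \<and> (\<forall>N\<in>\<N>. P N) \<and> (\<forall>M\<in>\<N>. \<forall>N\<in>\<N>. M \<union> N \<in> \<N>)}"
  have "{{}} \<in> \<I>"
    using assms by (simp add: \<I>_def)
  moreover have "\<Union>\<C> \<in> \<I>" if \<C>: "\<C> \<noteq> {}" "subset.chain \<I> \<C>" for \<C>
  proof -
    have sub: "\<C> \<subseteq> \<I>" and chain: "\<And>\<A> \<B>. \<A> \<in> \<C> \<Longrightarrow> \<B> \<in> \<C> \<Longrightarrow> \<A> \<subseteq> \<B> \<or> \<B> \<subseteq> \<A>"
      using \<C>(2) by (auto simp: subset.chain_def subset_iff)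
    have "M \<union> N \<in> \<Union>\<C>" if MN: "M \<in> \<Union>\<C>" "N \<in> \<Union>\<C>" for M N
    proof -
      obtain \<A> \<B> where AB: "\<A> \<in> \<C>" "\<B> \<in> \<C>" "M \<in> \<A>" "N \<in> \<B>"
        using MN by blast
      then obtain \<D> where "\<D> \<in> \<C>" "M \<in> \<D>" "N \<in> \<D>"
        using chain[of \<A> \<B>] by blast
      moreover from this have "\<D> \<in> \<I>"
        using sub by blast
      ultimately have "M \<union> N \<in> \<D>"
        by (simp add: \<I>_def)
      then show ?thesis
        using \<open>\<D> \<in> \<C>\<close> by blast
    qed
    then show ?thesis
      using sub \<C>(1) by (auto simp: \<I>_def)
  qed
  ultimately obtain \<N> where \<N>: "\<N> \<in> \<I>" and max: "\<And>\<M>. \<M> \<in> \<I> \<Longrightarrow> \<N> \<subseteq> \<M> \<Longrightarrow> \<M> = \<N>"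
    using subset_Zorn_nonempty[of \<I>] by blast
  have \<N>0: "{} \<in> \<N>" and \<N>P: "\<And>N. N \<in> \<N> \<Longrightarrow> P N"
    and \<N>Un: "\<And>M N. M \<in> \<N> \<Longrightarrow> N \<in> \<N> \<Longrightarrow> M \<union> N \<in> \<N>"
    using \<N> by (simp_all add: \<I>_def)
  have maximal: "S \<in> \<N>" if S: "\<forall>N\<in>\<N>. P (N \<union> S)" for S
  proof -
    define \<M> where "\<M> = {M. \<exists>N\<in>\<N>. M = N \<or> M = N \<union> S}"
    have "M \<union> N \<in> \<M>" if MN: "M \<in> \<M>" "N \<in> \<M>" for M N
    proof -
      obtain M' where M': "M' \<in> \<N>" "M = M' \<or> M = M' \<union> S"
        using MN(1) unfolding \<M>_def by blast
      obtain N' where N': "N' \<in> \<N>" "N = N' \<or> N = N' \<union> S"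
        using MN(2) unfolding \<M>_def by blast
      have "M \<union> N = M' \<union> N' \<or> M \<union> N = (M' \<union> N') \<union> S"
        using M'(2) N'(2) by auto
      then show ?thesis
        unfolding \<M>_def using \<N>Un[OF M'(1) N'(1)] by blast
    qed
    moreover have "P M" if "M \<in> \<M>" for M
      using that S \<N>P unfolding \<M>_def by auto
    moreover have "{} \<in> \<M>" "S \<in> \<M>" "\<N> \<subseteq> \<M>"
      using \<N>0 unfolding \<M>_def by auto
    ultimately have "\<M> \<in> \<I>"
      by (simp add: \<I>_def)
    then show ?thesis
      using max[OF _ \<open>\<N> \<subseteq> \<M>\<close>] \<open>S \<in> \<M>\<close> by simp
  qed
  show ?thesis
    by (intro exI[of _ \<N>] conjI ballI allI impI) (fact \<N>0 | erule \<N>P | erule (1) \<N>Un | erule maximal)+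
qed

lemma countable_subset_range:
  fixes A :: "'a set"
  assumes "countable A"
  shows "\<exists>s :: nat \<Rightarrow> 'a. A \<subseteq> range s"
proof (cases "A = {}")
  case False
  then show ?thesis
    using assms by (metis range_from_nat_into subset_refl)
qed simp

section \<open>A saturated incidence\<close>

text \<open>
  The values \<open>d k g\<close> and \<open>x e g\<close> are those of the \<open>k\<close>-th point of \<open>D\<close> and of the \<open>e\<close>-th
  point of \<open>E\<close> at the coordinate \<open>g\<close>. Null sets are sets of indices of points of \<open>D\<close>.
\<close>

locale saturated_incidence =
  fixes d :: "nat \<Rightarrow> real \<Rightarrow> bool" and x :: "real \<Rightarrow> real \<Rightarrow> bool" and null :: "nat set set"
  assumes null_Un: "M \<in> null \<Longrightarrow> N \<in> null \<Longrightarrow> M \<union> N \<in> null"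
    and null_singleton: "{k} \<in> null"
    and cylinder_not_null:
      "finite K \<Longrightarrow> N \<in> null \<Longrightarrow> \<exists>k. k \<notin> N \<and> (\<forall>g\<in>K. d k g = p g)"
    and null_maximal:
      "(\<And>N K p. N \<in> null \<Longrightarrow> finite K \<Longrightarrow> \<exists>k. k \<notin> N \<union> M \<and> (\<forall>g\<in>K. d k g = p g)) \<Longrightarrow> M \<in> null"
    and countable_pattern_realized: "countable J \<Longrightarrow> \<exists>e. \<forall>g\<in>J. x e g = p g"
    and interpolating_coordinate:
      "countable A \<Longrightarrow> N \<in> null \<Longrightarrow> \<exists>g. (\<forall>e\<in>A. x e g = b e) \<and> (\<forall>k\<in>N. d k g = c k)"

text \<open>
  Two demands compete for the value of a point of \<open>E\<close> at a coordinate: the pattern coded by the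
  point and the function coded by the coordinate. The point has priority. The function coded by
  a coordinate is still realised, because countably many points restrict only countably many
  coordinates, while uncountably many coordinates, which differ in their tags, code that function.
  
  On \<open>D\<close>, a coordinate whose set of indices is null is modified on this set only. Every cylinder
  then agrees up to a null set with the corresponding cylinder of the independent family, so
  density, the ideal property and maximality survive the modification.
\<close>

lemma saturated_incidence_exists: "\<exists>d x null. saturated_incidence d x null"
proof -
  obtain \<psi> :: "real \<Rightarrow> (nat \<Rightarrow> real) \<times> (nat \<Rightarrow> bool)" where \<psi>: "surj \<psi>"
    using surj_point_code by blast
  obtain \<phi> :: "real \<Rightarrow> (nat \<Rightarrow> real) \<times> (nat \<Rightarrow> bool) \<times> nat set \<times> (nat \<Rightarrow> bool) \<times> real"
    where \<phi>: "surj \<phi>"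
    using surj_coordinate_code by blast
  obtain B :: "nat \<Rightarrow> real \<Rightarrow> bool" where
    B: "\<And>K p. finite K \<Longrightarrow> \<exists>k. \<forall>r\<in>K. B k r = p r"
    using independent_family_on_nat by blast
  define codense where "codense = (\<lambda>N. \<forall>K p. finite K \<longrightarrow> (\<exists>k. k \<notin> N \<and> (\<forall>r\<in>K. B k r = p r)))"
  have codense_empty: "codense {}"
    unfolding codense_def
  proof (intro allI impI)
    fix K :: "real set" and p assume "finite K"
    from B[OF this, of p] show "\<exists>k. k \<notin> {} \<and> (\<forall>r\<in>K. B k r = p r)"
      by simp
  qed
  obtain null where null: "{} \<in> null \<and> (\<forall>N\<in>null. codense N) \<and>
      (\<forall>M\<in>null. \<forall>N\<in>null. M \<union> N \<in> null) \<and> (\<forall>S. (\<forall>N\<in>null. codense (N \<union> S)) \<longrightarrow> S \<in> null)"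
    using maximal_ideal_avoiding[of codense, OF codense_empty] by (elim exE) (rule that)
  have null0: "{} \<in> null" and codense: "\<And>N. N \<in> null \<Longrightarrow> codense N"
    and Un: "\<And>M N. M \<in> null \<Longrightarrow> N \<in> null \<Longrightarrow> M \<union> N \<in> null"
    using null by blast+
  have max: "S \<in> null" if "\<And>N. N \<in> null \<Longrightarrow> codense (N \<union> S)" for S
    using null that by blast
  have avoid: "\<exists>k. k \<notin> N \<and> (\<forall>r\<in>K. B k r = p r)" if "N \<in> null" "finite K" for N K p
    using codense[OF that(1)] that(2) unfolding codense_def by blast
  define nul where "nul = (\<lambda>g. fst (snd (snd (\<phi> g))))"
  define modif where "modif = (\<lambda>g. fst (snd (snd (snd (\<phi> g)))))"
  define d where "d = (\<lambda>k g. if nul g \<in> null \<and> k \<in> nul g then modif g k else B k g)"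
  define x where "x = (\<lambda>e g.
    if \<exists>n. fst (\<psi> e) n = g then snd (\<psi> e) (LEAST n. fst (\<psi> e) n = g)
    else fst (snd (\<phi> g)) (LEAST n. fst (\<phi> g) n = e))"
  \<comment> \<open>Finitely many coordinates differ from those of the independent family on a null set only.\<close>
  have small: "\<exists>N\<in>null. \<forall>k. k \<notin> N \<longrightarrow> (\<forall>g\<in>K. d k g = B k g)" if "finite K" for K
    using that
  proof induction
    case empty
    show ?case by (rule bexI[OF _ null0]) simp
  next
    case (insert g K)
    then obtain N where N: "N \<in> null" "\<And>k. k \<notin> N \<Longrightarrow> \<forall>g\<in>K. d k g = B k g"
      by blast
    let ?N = "N \<union> (if nul g \<in> null then nul g else {})"
    have "?N \<in> null"
      using N(1) Un null0 by auto
    moreover have "\<forall>g\<in>insert g K. d k g = B k g" if "k \<notin> ?N" for k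
      using that N(2) by (auto simp: d_def split: if_splits)
    ultimately show ?case by blast
  qed
  have "saturated_incidence d x null"
  proof
    show "M \<union> N \<in> null" if "M \<in> null" "N \<in> null" for M N
      using that by (rule Un)
    show "{k} \<in> null" for k
    proof (rule max, unfold codense_def, intro allI impI)
      fix N and K :: "real set" and p assume N: "N \<in> null" and K: "finite K"
      obtain r :: real where r: "r \<notin> K"
        using K ex_new_if_finite infinite_UNIV_char_0 by blast
      \<comment> \<open>One further coordinate \<open>r\<close>, prescribed against its value at \<open>k\<close>, keeps the index found
        away from \<open>k\<close>.\<close>
      obtain j where "j \<notin> N" "\<forall>s\<in>insert r K. B j s = (p(r := \<not> B k r)) s"
        using avoid[OF N, of "insert r K" "p(r := \<not> B k r)"] K by auto
      then show "\<exists>j. j \<notin> N \<union> {k} \<and> (\<forall>s\<in>K. B j s = p s)"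
        using r by (intro exI[of _ j]) auto
    qed
    show "\<exists>k. k \<notin> N \<and> (\<forall>g\<in>K. d k g = p g)" if K: "finite K" and N: "N \<in> null" for N K p
    proof -
      obtain N' where N': "N' \<in> null" "\<And>k. k \<notin> N' \<Longrightarrow> \<forall>g\<in>K. d k g = B k g"
        using small[OF K] by blast
      obtain k where "k \<notin> N \<union> N'" "\<forall>g\<in>K. B k g = p g"
        using avoid[OF Un[OF N N'(1)] K, of p] by blast
      then show ?thesis
        using N'(2) by (intro exI[of _ k]) auto
    qed
    show "M \<in> null"
      if M: "\<And>N K p. N \<in> null \<Longrightarrow> finite K \<Longrightarrow> \<exists>k. k \<notin> N \<union> M \<and> (\<forall>g\<in>K. d k g = p g)" for M
    proof (rule max, unfold codense_def, intro allI impI)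
      fix N and K :: "real set" and p assume N: "N \<in> null" and K: "finite K"
      obtain N' where N': "N' \<in> null" "\<And>k. k \<notin> N' \<Longrightarrow> \<forall>g\<in>K. d k g = B k g"
        using small[OF K] by blast
      show "\<exists>k. k \<notin> N \<union> M \<and> (\<forall>s\<in>K. B k s = p s)"
        using M[OF Un[OF N N'(1)] K, of p] N'(2) by fastforce
    qed
    show "\<exists>e. \<forall>g\<in>J. x e g = p g" if J: "countable J" for J p
    proof -
      obtain s :: "nat \<Rightarrow> real" where s: "J \<subseteq> range s"
        using J by (metis countable_subset_range)
      obtain e where e: "\<psi> e = (s, \<lambda>n. p (s n))"
        using \<psi> by (metis surjD)
      have "x e g = p g" if "g \<in> J" for g
      proof -
        have "\<exists>n. s n = g" using that s by auto
        then show ?thesis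
          using LeastI_ex[of "\<lambda>n. s n = g"] by (simp add: x_def e)
      qed
      then show ?thesis by blast
    qed
    show "\<exists>g. (\<forall>e\<in>A. x e g = b e) \<and> (\<forall>k\<in>N. d k g = c k)"
      if A: "countable A" and N: "N \<in> null" for A N b c
    proof -
      obtain s :: "nat \<Rightarrow> real" where s: "A \<subseteq> range s"
        using A by (metis countable_subset_range)
      define \<gamma> where "\<gamma> = (\<lambda>t. inv \<phi> (s, \<lambda>n. b (s n), N, c, t))"
      have \<gamma>: "\<phi> (\<gamma> t) = (s, \<lambda>n. b (s n), N, c, t)" for t
        unfolding \<gamma>_def by (rule surj_f_inv_f[OF \<phi>])
      have "inj \<gamma>"
      proof (rule injI)
        fix t u assume "\<gamma> t = \<gamma> u"
        then have "\<phi> (\<gamma> t) = \<phi> (\<gamma> u)" by simp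
        then show "t = u" by (simp add: \<gamma>)
      qed
      then have "uncountable (range \<gamma>)"
        using countable_image_inj_on uncountable_UNIV_real by blast
      moreover have "countable (\<Union>e\<in>A. range (fst (\<psi> e)))"
        using A by auto
      ultimately obtain t where t: "\<gamma> t \<notin> (\<Union>e\<in>A. range (fst (\<psi> e)))"
        using countable_subset[of "range \<gamma>" "\<Union>e\<in>A. range (fst (\<psi> e))"] by blast
      have "x e (\<gamma> t) = b e" if "e \<in> A" for e
      proof -
        have "\<not> (\<exists>n. fst (\<psi> e) n = \<gamma> t)"
          using t that by (metis UN_I rangeI)
        moreover have "\<exists>n. s n = e" using that s by auto
        ultimately show ?thesis
          using LeastI_ex[of "\<lambda>n. s n = e"] by (simp add: x_def \<gamma>)
      qed
      moreover have "d k (\<gamma> t) = c k" if "k \<in> N" for k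
        using that N by (simp add: d_def nul_def modif_def \<gamma>)
      ultimately show ?thesis by blast
    qed
  qed
  then show ?thesis by blast
qed

section \<open>Cylinders in spaces of real functions\<close>

definition finitely_determined :: "('i \<Rightarrow> real) set \<Rightarrow> (('i \<Rightarrow> real) \<Rightarrow> 'b) \<Rightarrow> bool" where
  "finitely_determined S F \<longleftrightarrow>
     (\<exists>K. finite K \<and> (\<forall>y\<in>S. \<forall>z\<in>S. (\<forall>i\<in>K. y i = z i) \<longrightarrow> F y = F z))"

lemma open_cylinder:
  fixes y :: "'i \<Rightarrow> real"
  assumes "finite K"
  shows "open {z. \<forall>i\<in>K. \<bar>z i - y i\<bar> < e}"
proof -
  have "open {z :: 'i \<Rightarrow> real. \<bar>z i - y i\<bar> < e}" for i
    by (intro open_Collect_less continuous_intros continuous_on_product_coordinates)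
  moreover have "{z. \<forall>i\<in>K. \<bar>z i - y i\<bar> < e} = (\<Inter>i\<in>K. {z. \<bar>z i - y i\<bar> < e})"
    by auto
  ultimately show ?thesis
    using assms by auto
qed

lemma open_contains_cylinder:
  fixes U :: "('i \<Rightarrow> real) set"
  assumes "open U" "y \<in> U"
  shows "\<exists>K. finite K \<and> (\<forall>z. (\<forall>i\<in>K. z i = y i) \<longrightarrow> z \<in> U)"
proof -
  have "openin (product_topology (\<lambda>_. euclidean) UNIV) U"
    using assms(1) by (simp add: euclidean_product_topology)
  then obtain X where X: "y \<in> Pi\<^sub>E UNIV X" "finite {i. X i \<noteq> UNIV}" "Pi\<^sub>E UNIV X \<subseteq> U"
    using assms(2) product_topology_open_contains_basis[of "\<lambda>_. euclidean" UNIV U y] by auto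
  have "z \<in> U" if "\<forall>i\<in>{i. X i \<noteq> UNIV}. z i = y i" for z
    using that X(1,3) by (force simp: PiE_def Pi_def)
  then show ?thesis
    using X(2) by blast
qed

text \<open>
  The coordinates take only the values 0 and 1, so fixing finitely many of them defines an open set.
\<close>

lemma continuous_on_finitely_determined:
  fixes F :: "('i \<Rightarrow> real) \<Rightarrow> 'b :: topological_space"
  assumes S: "\<And>y i. y \<in> S \<Longrightarrow> y i \<in> {0, 1}" and F: "finitely_determined S F"
  shows "continuous_on S F"
proof -
  obtain K where K: "finite K"
    and det: "\<And>y z. y \<in> S \<Longrightarrow> z \<in> S \<Longrightarrow> \<forall>i\<in>K. y i = z i \<Longrightarrow> F y = F z"
    using F unfolding finitely_determined_def by blast
  show ?thesis
    unfolding continuous_on_topological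
  proof (intro ballI allI impI)
    fix y B assume y: "y \<in> S" and B: "open B" "F y \<in> B"
    let ?A = "{z. \<forall>i\<in>K. \<bar>z i - y i\<bar> < 1}"
    have "F z \<in> B" if z: "z \<in> S" "z \<in> ?A" for z
    proof -
      have "z i = y i" if "i \<in> K" for i
        using S[OF y, of i] S[OF z(1), of i] z(2) that by fastforce
      then show ?thesis
        using det[OF z(1) y] B(2) by simp
    qed
    then show "\<exists>A. open A \<and> y \<in> A \<and> (\<forall>z\<in>S. z \<in> A \<longrightarrow> F z \<in> B)"
      using open_cylinder[OF K, of y 1] by (intro exI[of _ ?A]) auto
  qed
qed

text \<open>
  Compactness of a power of the unit interval, in terms of finitely many coordinates at a time.
\<close>

lemma bounded_sequence_cluster_function:
  fixes u :: "nat \<Rightarrow> 'i \<Rightarrow> real"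
  assumes u: "\<And>n i. u n i \<in> {0..1}"
  shows "\<exists>q. (\<forall>i. q i \<in> {0..1}) \<and>
    (\<forall>K m e. finite K \<longrightarrow> e > 0 \<longrightarrow> (\<exists>n\<ge>m. \<forall>i\<in>K. \<bar>u n i - q i\<bar> < e))"
proof -
  define S where "S = Pi\<^sub>E UNIV (\<lambda>_ :: 'i. {0..1 :: real})"
  have "compactin (product_topology (\<lambda>_. euclideanreal) UNIV) S"
    unfolding S_def by (subst compactin_PiE) auto
  then have comp: "compact_space (top_of_set S)"
    by (simp add: euclidean_product_topology compact_space_subtopology)
  have uS: "u n \<in> S" for n
    using u by (auto simp: S_def)
  define C where "C = (\<lambda>m. S \<inter> closure {u n | n. m \<le> n})"
  have "(\<Inter>m. C m) \<noteq> {}"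
  proof (rule compact_space_imp_nest[OF comp])
    show "closedin (top_of_set S) (C m)" for m
      unfolding C_def by (simp add: closedin_closed_Int)
    have "u m \<in> C m" for m
      using uS closure_subset[of "{u n | n. m \<le> n}"] by (auto simp: C_def)
    then show "C m \<noteq> {}" for m by blast
    show "decseq C"
      unfolding C_def by (intro decseq_SucI Int_mono closure_mono order_refl) auto
  qed
  then obtain q where q: "\<And>m. q \<in> C m" by blast
  have "\<exists>n\<ge>m. \<forall>i\<in>K. \<bar>u n i - q i\<bar> < e" if "finite K" "e > 0" for K m e
  proof -
    let ?U = "{z. \<forall>i\<in>K. \<bar>z i - q i\<bar> < e}"
    have "q \<in> ?U" "q \<in> closure {u n | n. m \<le> n}"
      using q[of m] that(2) by (simp_all add: C_def)
    then have "?U \<inter> {u n | n. m \<le> n} \<noteq> {}"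
      using open_Int_closure_eq_empty[OF open_cylinder[OF that(1), of q e], of "{u n | n. m \<le> n}"]
      by blast
    then show ?thesis by blast
  qed
  moreover have "\<forall>i. q i \<in> {0..1}"
    using q[of 0] by (auto simp: C_def S_def)
  ultimately show ?thesis by blast
qed

section \<open>Baire-one extension of functions on countable sets\<close>

text \<open>
  The digits are those of the doubling map: at each step the remainder is doubled, and 1 is
  subtracted if the remainder was at least one half. The invariant is that all remainders
  stay in the unit interval, and this includes the case of the number 1.
\<close>

lemma binary_digits:
  fixes t :: real
  assumes "0 \<le> t" "t \<le> 1"
  shows "\<exists>b :: nat \<Rightarrow> bool. (\<lambda>k. of_bool (b k) / 2 ^ Suc k) sums t"
proof -
  define r where "r = rec_nat t (\<lambda>_ s. 2 * s - of_bool (s \<ge> 1 / 2))"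
  have r0: "r 0 = t" and rSuc: "r (Suc n) = 2 * r n - of_bool (r n \<ge> 1 / 2)" for n
    by (simp_all add: r_def)
  have r01: "0 \<le> r n \<and> r n \<le> 1" for n
    by (induction n) (use assms in \<open>auto simp: r0 rSuc\<close>)
  have partial: "(\<Sum>k<n. of_bool (r k \<ge> 1 / 2) / 2 ^ Suc k) = t - r n / 2 ^ n" for n
    by (induction n) (auto simp: r0 rSuc field_simps)
  have "(\<lambda>n. (1 / 2) ^ n :: real) \<longlonglongrightarrow> 0"
    by (rule LIMSEQ_realpow_zero) auto
  then have "(\<lambda>n. r n / 2 ^ n) \<longlonglongrightarrow> 0"
    by (rule Lim_null_comparison[rotated])
      (use r01 in \<open>auto simp: power_one_over divide_simps intro!: always_eventually\<close>)
  then have "(\<lambda>n. t - r n / 2 ^ n) \<longlonglongrightarrow> t - 0"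
    by (intro tendsto_intros)
  then show ?thesis
    unfolding sums_def by (intro exI[of _ "\<lambda>k. r k \<ge> 1 / 2"]) (simp only: partial diff_zero)
qed

context saturated_incidence
begin

lemma finite_null: "finite N \<Longrightarrow> N \<noteq> {} \<Longrightarrow> N \<in> null"
proof (induction N rule: finite_ne_induct)
  case (insert k N)
  then show ?case
    using null_Un[OF null_singleton[of k] insert.IH] by simp
qed (rule null_singleton)

text \<open>
  Submaximality of \<open>D\<close>. If \<open>M\<close> is not null, then by maximality some cylinder is covered by
  \<open>M\<close> and a null set \<open>N\<close>. It contains a point outside \<open>M\<close>, hence in \<open>N\<close>. A coordinate isolates
  this point inside \<open>N\<close>, and a second new coordinate excludes the point itself. The smaller
  cylinder so obtained is contained in \<open>M\<close>, contrary to the density of the complement of \<open>M\<close>.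
\<close>

lemma codense_null:
  assumes codense: "\<And>K p. finite K \<Longrightarrow> \<exists>k. k \<notin> M \<and> (\<forall>g\<in>K. d k g = p g)"
  shows "M \<in> null"
proof (rule null_maximal, rule ccontr)
  fix N and K :: "real set" and p
  assume N: "N \<in> null" and K: "finite K"
    and "\<not> (\<exists>k. k \<notin> N \<union> M \<and> (\<forall>g\<in>K. d k g = p g))"
  then have cover: "k \<in> N \<or> k \<in> M" if "\<forall>g\<in>K. d k g = p g" for k
    using that by blast
  obtain j where j: "j \<notin> M" "\<forall>g\<in>K. d j g = p g"
    using codense[OF K, of p] by blast
  obtain g where g: "\<forall>k\<in>N. d k g = (k = j)"
    using interpolating_coordinate[OF countable_empty N, of _ "\<lambda>k. k = j"] by blast
  obtain h where h: "h \<notin> insert g K"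
    using K ex_new_if_finite[of "insert g K"] infinite_UNIV_char_0 by blast
  define q where "q = (d j)(h := \<not> d j h)"
  obtain k where k: "k \<notin> M" "\<forall>i\<in>insert h (insert g K). d k i = q i"
    using codense[of "insert h (insert g K)" q] K by blast
  have "\<forall>i\<in>K. d k i = p i"
    using k(2) j(2) h by (auto simp: q_def split: if_splits)
  then have "k \<in> N"
    using cover k(1) by blast
  moreover have "d k g"
    using k(2) h g cover j by (auto simp: q_def)
  ultimately have "k = j"
    using g by blast
  then show False
    using k(2) by (simp add: q_def)
qed

text \<open>
  The set consists of the points of \<open>D\<close> near which \<open>f\<close> is not constant. Its part of each colour
  has dense complement, since every neighbourhood of a point of this part contains a
  point of the other colour.
\<close>

lemma two_colouring_null_boundary:
  fixes f :: "nat \<Rightarrow> bool"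
  shows "{k. \<forall>K. finite K \<longrightarrow> (\<exists>i. (\<forall>g\<in>K. d i g = d k g) \<and> f i \<noteq> f k)} \<in> null" (is "?R \<in> null")
proof -
  have "{k \<in> ?R. f k = b} \<in> null" for b
  proof (rule codense_null)
    fix K :: "real set" and p assume K: "finite K"
    obtain k where k: "\<forall>g\<in>K. d k g = p g"
      using cylinder_not_null[OF K null_singleton] by blast
    show "\<exists>k. k \<notin> {k \<in> ?R. f k = b} \<and> (\<forall>g\<in>K. d k g = p g)"
    proof (cases "k \<in> {k \<in> ?R. f k = b}")
      case True
      then obtain i where "\<forall>g\<in>K. d i g = d k g" "f i \<noteq> b"
        using K by blast
      then show ?thesis using k by auto
    qed (use k in blast)
  qed
  then have "{k \<in> ?R. f k = True} \<union> {k \<in> ?R. f k = False} \<in> null"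
    by (intro null_Un)
  moreover have "{k \<in> ?R. f k = True} \<union> {k \<in> ?R. f k = False} = ?R"
    by auto
  ultimately show ?thesis by simp
qed

definition dpt :: "nat \<Rightarrow> real \<Rightarrow> real" where "dpt k = (\<lambda>g. of_bool (d k g))"

definition xpt :: "real \<Rightarrow> real \<Rightarrow> real" where "xpt e = (\<lambda>g. of_bool (x e g))"

definition pts :: "(real \<Rightarrow> real) set" where "pts = range dpt \<union> range xpt"

lemma dpt_in_pts [simp]: "dpt k \<in> pts"
  by (simp add: pts_def)

lemma xpt_in_pts [simp]: "xpt e \<in> pts"
  by (simp add: pts_def)

lemma dpt_eq_iff: "dpt k g = dpt i g \<longleftrightarrow> d k g = d i g"
  by (simp add: dpt_def)

lemma pts_01: "y \<in> pts \<Longrightarrow> y g \<in> {0, 1}"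
  by (auto simp: pts_def dpt_def xpt_def)

lemma continuous_on_pts: "finitely_determined pts F \<Longrightarrow> continuous_on pts F"
  by (rule continuous_on_finitely_determined) (rule pts_01)

text \<open>
  Nonempty cylinders meet \<open>D\<close> outside any given null set; in particular \<open>D\<close> is
  dense and has no isolated points.
\<close>

lemma dpt_in_cylinder:
  assumes "finite K" "N \<in> null" "\<And>g. g \<in> K \<Longrightarrow> p g \<in> {0, 1 :: real}"
  shows "\<exists>k. k \<notin> N \<and> (\<forall>g\<in>K. dpt k g = p g)"
proof -
  obtain k where "k \<notin> N" "\<forall>g\<in>K. d k g = (p g = 1)"
    using cylinder_not_null[OF assms(1,2), of "\<lambda>g. p g = 1"] by blast
  then show ?thesis
    using assms(3) by (intro exI[of _ k]) (force simp: dpt_def)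
qed

lemma xpt_realizes:
  assumes "countable J" "\<And>g. g \<in> J \<Longrightarrow> p g \<in> {0, 1 :: real}"
  shows "\<exists>e. \<forall>g\<in>J. xpt e g = p g"
proof -
  obtain e where "\<forall>g\<in>J. x e g = (p g = 1)"
    using countable_pattern_realized[OF assms(1), of "\<lambda>g. p g = 1"] by blast
  then show ?thesis
    using assms(2) by (intro exI[of _ e]) (force simp: xpt_def)
qed

text \<open>
  Off a null set \<open>R\<close>, every point \<open>d k\<close> has a cylinder \<open>W k\<close> on which \<open>f\<close> is constant. A coordinate
  \<open>g\<close> realises the prescribed values on \<open>A\<close> and on \<open>R\<close>. The function to be constructed has the
  constant values of \<open>f\<close> on the cylinders and agrees with \<open>g\<close> elsewhere; but the cylinders may
  contain points of \<open>A\<close>. Therefore \<open>A\<close> is protected by coordinates \<open>c j\<close> that are 1 on all of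
  \<open>A\<close> and 0 at \<open>d j\<close>: where they are all 1, the value is that of \<open>g\<close>. The \<open>n\<close>-th approximation
  uses the first \<open>n\<close> cylinders and protecting coordinates only, and it stabilises at each
  point, because both conditions change at most once as \<open>n\<close> grows.
\<close>

lemma binary_baire_one_extension:
  assumes A: "countable A"
  shows "\<exists>(F :: nat \<Rightarrow> _) h. (\<forall>n. finitely_determined pts (F n)) \<and> (\<forall>n. \<forall>y\<in>pts. F n y \<in> {0, 1 :: real}) \<and>
      (\<forall>y\<in>pts. \<exists>m. \<forall>n\<ge>m. F n y = h y) \<and>
      (\<forall>e\<in>A. h (xpt e) = of_bool (a e)) \<and> (\<forall>k. h (dpt k) = of_bool (f k))"
proof -
  define R where "R = {k. \<forall>K. finite K \<longrightarrow> (\<exists>i. (\<forall>g\<in>K. d i g = d k g) \<and> f i \<noteq> f k)}"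
  have R: "R \<in> null"
    unfolding R_def by (rule two_colouring_null_boundary)
  have "\<forall>k. \<exists>K. finite K \<and> (k \<notin> R \<longrightarrow> (\<forall>i. (\<forall>g\<in>K. d i g = d k g) \<longrightarrow> f i = f k))"
  proof
    fix k
    show "\<exists>K. finite K \<and> (k \<notin> R \<longrightarrow> (\<forall>i. (\<forall>g\<in>K. d i g = d k g) \<longrightarrow> f i = f k))"
    proof (cases "k \<in> R")
      case True
      then show ?thesis by (intro exI[of _ "{}"]) simp
    next
      case False
      then show ?thesis unfolding R_def by blast
    qed
  qed
  from choice[OF this] obtain K
    where "\<forall>k. finite (K k) \<and> (k \<notin> R \<longrightarrow> (\<forall>i. (\<forall>g\<in>K k. d i g = d k g) \<longrightarrow> f i = f k))"
    by (elim exE)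
  then have K: "\<And>k. finite (K k)"
    and Kf: "\<And>k i. k \<notin> R \<Longrightarrow> \<forall>g\<in>K k. d i g = d k g \<Longrightarrow> f i = f k"
    by blast+
  obtain g where gA: "\<forall>e\<in>A. x e g = a e" and gR: "\<forall>k\<in>R. d k g = f k"
    using interpolating_coordinate[OF A R, of a f] by blast
  have "\<exists>c. (\<forall>e\<in>A. x e c = True) \<and> (\<forall>k\<in>{j}. d k c = False)" for j
    by (rule interpolating_coordinate[OF A null_singleton])
  then have "\<forall>j. \<exists>c. (\<forall>e\<in>A. x e c) \<and> \<not> d j c"
    by simp
  then obtain c where cA: "\<And>j e. e \<in> A \<Longrightarrow> x e (c j)" and cd: "\<And>j. \<not> d j (c j)"
    by metis
  define W where "W = (\<lambda>i y. i \<notin> R \<and> (\<forall>r\<in>K i. y r = dpt i r))"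
  define F :: "nat \<Rightarrow> (real \<Rightarrow> real) \<Rightarrow> real" where
    "F = (\<lambda>n y. if (\<forall>j\<le>n. y (c j) = 1) \<or> \<not> (\<exists>i\<le>n. W i y) then y g
            else of_bool (f (LEAST i. W i y)))"
  define h :: "(real \<Rightarrow> real) \<Rightarrow> real" where
    "h = (\<lambda>y. if (\<forall>j. y (c j) = 1) \<or> \<not> (\<exists>i. W i y) then y g
            else of_bool (f (LEAST i. W i y)))"
  have W_dpt: "i \<notin> R \<and> f k = f i" if "W i (dpt k)" for i k
  proof
    show "i \<notin> R" using that by (simp add: W_def)
    moreover have "\<forall>g\<in>K i. d k g = d i g"
      using that by (simp add: W_def dpt_eq_iff)
    ultimately show "f k = f i" by (rule Kf)
  qed
  have det: "finitely_determined pts (F n)" for n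
    unfolding finitely_determined_def
  proof (intro exI[of _ "insert g (c ` {..n} \<union> (\<Union>i\<le>n. K i))"] conjI ballI impI)
    show "finite (insert g (c ` {..n} \<union> (\<Union>i\<le>n. K i)))"
      using K by auto
    fix y z :: "real \<Rightarrow> real"
    assume eq: "\<forall>i\<in>insert g (c ` {..n} \<union> (\<Union>i\<le>n. K i)). y i = z i"
    have Weq: "W i y = W i z" if "i \<le> n" for i
    proof -
      have "\<forall>r\<in>K i. y r = z r" using eq that by blast
      then show ?thesis by (simp add: W_def)
    qed
    have ceq: "y (c j) = z (c j)" if "j \<le> n" for j
      using eq that by auto
    have least: "(LEAST i. W i y) = (LEAST i. W i z)" if "i \<le> n" "W i y" for i
    proof (rule antisym)
      have "W i z" using that Weq by blast
      then have "(LEAST i. W i z) \<le> i" "W (LEAST i. W i z) z"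
        by (auto intro: Least_le LeastI)
      then show "(LEAST i. W i y) \<le> (LEAST i. W i z)"
        using Weq that(1) by (auto intro: Least_le)
      have "(LEAST i. W i y) \<le> i" "W (LEAST i. W i y) y"
        using that(2) by (auto intro: Least_le LeastI)
      then show "(LEAST i. W i z) \<le> (LEAST i. W i y)"
        using Weq that(1) by (auto intro: Least_le)
    qed
    have "(\<forall>j\<le>n. y (c j) = 1) = (\<forall>j\<le>n. z (c j) = 1)" and "y g = z g"
      using ceq eq by simp_all
    moreover have "(\<exists>i\<le>n. W i y) = (\<exists>i\<le>n. W i z)"
      using Weq by blast
    ultimately show "F n y = F n z"
      using least unfolding F_def by auto
  qed
  have bin: "F n y \<in> {0, 1}" if "y \<in> pts" for n y
    using pts_01[OF that, of g] by (auto simp: F_def)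
  have conv: "\<exists>m. \<forall>n\<ge>m. F n y = h y" for y
  proof (cases "(\<forall>j. y (c j) = 1) \<or> \<not> (\<exists>i. W i y)")
    case True
    then show ?thesis by (auto simp: F_def h_def)
  next
    case False
    then obtain j i where "y (c j) \<noteq> 1" "W i y" by blast
    have "F n y = h y" if "n \<ge> max i j" for n
    proof -
      have "\<not> (\<forall>j\<le>n. y (c j) = 1)" "\<exists>i\<le>n. W i y"
        using that \<open>y (c j) \<noteq> 1\<close> \<open>W i y\<close> by auto
      with False show ?thesis by (auto simp: F_def h_def)
    qed
    then show ?thesis by blast
  qed
  have hA: "h (xpt e) = of_bool (a e)" if "e \<in> A" for e
    using that cA gA by (simp add: h_def xpt_def)
  have hD: "h (dpt k) = of_bool (f k)" for k
  proof (cases "k \<in> R")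
    case True
    \<comment> \<open>A cylinder on which \<open>f\<close> is constant contains no point near which \<open>f\<close> is not constant.\<close>
    have "\<not> W i (dpt k)" for i
    proof
      assume W: "W i (dpt k)"
      obtain j where j: "\<forall>g\<in>K i. d j g = d k g" "f j \<noteq> f k"
        using True K[of i] unfolding R_def by blast
      have "W i (dpt j)"
        using W j(1) by (auto simp: W_def dpt_eq_iff)
      then show False
        using W_dpt[OF W] W_dpt[of i j] j(2) by simp
    qed
    then show ?thesis
      using gR True by (simp add: h_def dpt_def)
  next
    case False
    then have "W k (dpt k)" by (simp add: W_def)
    then have "W (LEAST i. W i (dpt k)) (dpt k)" by (rule LeastI)
    then have "f k = f (LEAST i. W i (dpt k))"
      using W_dpt by blast
    moreover have "dpt k (c k) \<noteq> 1" using cd by (simp add: dpt_def)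
    ultimately show ?thesis
      using \<open>W k (dpt k)\<close> by (auto simp: h_def)
  qed
  show ?thesis
    by (intro exI[of _ F] exI[of _ h] conjI allI ballI) (rule det conv hD | erule bin hA)+
qed

text \<open>
  The binary digits are extended separately. At each point the resulting approximations converge
  to the sum of the series of the extended digits by dominated convergence.
\<close>

lemma unit_valued_baire_one_extension:
  assumes A: "countable A" and f: "\<And>y. 0 \<le> f y \<and> f y \<le> (1 :: real)"
  shows "\<exists>(F :: nat \<Rightarrow> _) h. (\<forall>n. continuous_on pts (F n)) \<and> (\<forall>n. \<forall>y. y \<in> pts \<longrightarrow> 0 \<le> F n y \<and> F n y \<le> (1 :: real)) \<and>
      (\<forall>y\<in>pts. (\<lambda>n. F n y) \<longlonglongrightarrow> h y) \<and>
      (\<forall>e\<in>A. h (xpt e) = f (xpt e)) \<and> (\<forall>k. h (dpt k) = f (dpt k))"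
proof -
  have "\<forall>t. \<exists>b :: nat \<Rightarrow> bool. 0 \<le> t \<and> t \<le> 1 \<longrightarrow> (\<lambda>k. of_bool (b k) / 2 ^ Suc k) sums (t :: real)"
    using binary_digits by blast
  from choice[OF this] obtain \<beta> :: "real \<Rightarrow> nat \<Rightarrow> bool"
    where \<beta>: "\<And>t. 0 \<le> t \<and> t \<le> 1 \<Longrightarrow> (\<lambda>k. of_bool (\<beta> t k) / 2 ^ Suc k) sums t"
    by blast
  define good where "good = (\<lambda>j (G :: nat \<Rightarrow> _). \<exists>g.
      (\<forall>n. finitely_determined pts (G n)) \<and> (\<forall>n. \<forall>y\<in>pts. G n y \<in> {0, 1 :: real}) \<and>
      (\<forall>y\<in>pts. \<exists>m. \<forall>n\<ge>m. G n y = g y) \<and>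
      (\<forall>e\<in>A. g (xpt e) = of_bool (\<beta> (f (xpt e)) j)) \<and> (\<forall>k. g (dpt k) = of_bool (\<beta> (f (dpt k)) j)))"
  have "\<forall>j. \<exists>G. good j G"
    unfolding good_def using binary_baire_one_extension[OF A] by (rule allI)
  from choice[OF this] obtain G where "\<forall>j. good j (G j)"
    by (elim exE)
  then have "\<forall>j. \<exists>g. (\<forall>n. finitely_determined pts (G j n)) \<and> (\<forall>n. \<forall>y\<in>pts. G j n y \<in> {0, 1 :: real}) \<and>
      (\<forall>y\<in>pts. \<exists>m. \<forall>n\<ge>m. G j n y = g y) \<and>
      (\<forall>e\<in>A. g (xpt e) = of_bool (\<beta> (f (xpt e)) j)) \<and> (\<forall>k. g (dpt k) = of_bool (\<beta> (f (dpt k)) j))"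
    by (simp add: good_def)
  from choice[OF this] obtain g where
    g: "\<forall>j. (\<forall>n. finitely_determined pts (G j n)) \<and> (\<forall>n. \<forall>y\<in>pts. G j n y \<in> {0, 1 :: real}) \<and>
      (\<forall>y\<in>pts. \<exists>m. \<forall>n\<ge>m. G j n y = g j y) \<and>
      (\<forall>e\<in>A. g j (xpt e) = of_bool (\<beta> (f (xpt e)) j)) \<and> (\<forall>k. g j (dpt k) = of_bool (\<beta> (f (dpt k)) j))"
    by (elim exE)
  have Gdet: "finitely_determined pts (G j n)" for j n
    using g by blast
  have G01: "G j n y \<in> {0, 1}" if "y \<in> pts" for j n y
    using g that by blast
  have Glim: "\<exists>m. \<forall>n\<ge>m. G j n y = g j y" if "y \<in> pts" for j y
    using g that by blast
  have gA: "g j (xpt e) = of_bool (\<beta> (f (xpt e)) j)" if "e \<in> A" for j e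
    using g that by blast
  have gD: "g j (dpt k) = of_bool (\<beta> (f (dpt k)) j)" for j k
    using g by blast
  define F where "F = (\<lambda>n y. \<Sum>j<n. G j n y / 2 ^ Suc j)"
  define h where "h = (\<lambda>y. \<Sum>j. g j y / 2 ^ Suc j)"
  have geom: "(\<Sum>j<n. 1 / 2 ^ Suc j) = 1 - 1 / (2 :: real) ^ n" for n
    by (induction n) (auto simp: field_simps)
  have cont: "continuous_on pts (F n)" for n
    unfolding F_def by (intro continuous_intros continuous_on_pts Gdet) simp
  have F01: "0 \<le> F n y \<and> F n y \<le> 1" if y: "y \<in> pts" for n y
  proof
    have G: "0 \<le> G j n y / 2 ^ Suc j \<and> G j n y / 2 ^ Suc j \<le> 1 / 2 ^ Suc j" for j
      using G01[OF y, of j n] by auto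
    then show "0 \<le> F n y"
      unfolding F_def by (intro sum_nonneg) blast
    have "F n y \<le> (\<Sum>j<n. 1 / 2 ^ Suc j)"
      unfolding F_def using G by (intro sum_mono) blast
    also have "\<dots> \<le> 1" by (simp only: geom) simp
    finally show "F n y \<le> 1" .
  qed
  have lim: "(\<lambda>n. F n y) \<longlonglongrightarrow> h y" if y: "y \<in> pts" for y
  proof -
    define a where "a = (\<lambda>j n. if j < n then G j n y / 2 ^ Suc j else 0)"
    have "summable (\<lambda>j. (1 / 2) ^ j :: real)"
      by (rule summable_geometric) simp
    moreover have "norm (a j n) \<le> (1 / 2) ^ j" for j n
      using G01[OF y, of j n] by (auto simp: a_def power_one_over divide_simps)
    moreover have "(\<lambda>n. a j n) \<longlonglongrightarrow> g j y / 2 ^ Suc j" for j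
    proof -
      obtain m where m: "\<forall>n\<ge>m. G j n y = g j y"
        using Glim[OF y] by blast
      have "eventually (\<lambda>n. a j n = g j y / 2 ^ Suc j) sequentially"
        using eventually_ge_at_top[of "max m (Suc j)"]
        by eventually_elim (use m in \<open>auto simp: a_def\<close>)
      then show ?thesis by (rule tendsto_eventually)
    qed
    ultimately have "(\<lambda>n. \<Sum>j. a j n) \<longlonglongrightarrow> h y"
      unfolding h_def
      using tannerys_theorem[of a "\<lambda>j. g j y / 2 ^ Suc j" sequentially "\<lambda>j. (1 / 2) ^ j"]
      by (simp add: always_eventually case_prod_unfold)
    moreover have "(\<Sum>j. a j n) = F n y" for n
    proof -
      have "(\<Sum>j. a j n) = (\<Sum>j\<in>{..<n}. a j n)"
        by (rule suminf_finite) (auto simp: a_def)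
      then show ?thesis by (simp add: a_def F_def)
    qed
    ultimately show ?thesis by simp
  qed
  have hA: "h (xpt e) = f (xpt e)" if "e \<in> A" for e
    using sums_unique[OF \<beta>[OF f, of "xpt e"]] gA[OF that] by (simp add: h_def)
  have hD: "h (dpt k) = f (dpt k)" for k
    using sums_unique[OF \<beta>[OF f, of "dpt k"]] gD by (simp add: h_def)
  show ?thesis
    by (intro exI[of _ F] exI[of _ h] conjI allI ballI impI)
      (fact cont hD | erule lim hA | use F01 in blast)+
qed

abbreviation "X \<equiv> top_of_set pts"

lemma countable_unit_extension:
  assumes C: "countable C" "C \<subseteq> pts" and f: "\<And>y. 0 \<le> f y \<and> f y \<le> (1 :: real)"
  shows "\<exists>h\<in>baire_one_functions X (top_of_set {0..1}). \<forall>y\<in>C. h y = f y"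
proof -
  define A where "A = (\<lambda>y. SOME e. xpt e = y) ` C"
  have A: "countable A"
    using C(1) by (simp add: A_def)
  obtain F h where F: "\<forall>n. continuous_on pts (F n)" "\<forall>n. \<forall>y. y \<in> pts \<longrightarrow> 0 \<le> F n y \<and> F n y \<le> (1 :: real)"
    "\<forall>y\<in>pts. (\<lambda>n. F n y) \<longlonglongrightarrow> h y"
    and h: "\<forall>e\<in>A. h (xpt e) = f (xpt e)" "\<forall>k. h (dpt k) = f (dpt k)"
    using unit_valued_baire_one_extension[of A f, OF A f] by (elim exE conjE)
  have h01: "h y \<in> {0..1}" if "y \<in> pts" for y
  proof -
    have l: "(\<lambda>n. F n y) \<longlonglongrightarrow> h y" using F(3) that by blast
    have "0 \<le> h y" by (rule LIMSEQ_le_const[OF l]) (use F(2) that in auto)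
    moreover have "h y \<le> 1" by (rule LIMSEQ_le_const2[OF l]) (use F(2) that in auto)
    ultimately show ?thesis by simp
  qed
  have "restrict h pts \<in> baire_one_functions X (top_of_set {0..1})"
    unfolding baire_one_functions_def
    using F h01 by (auto intro!: exI[of _ F] simp: limitin_subtopology continuous_map_in_subtopology image_subset_iff
        Pi_iff)
  moreover have "restrict h pts y = f y" if "y \<in> C" for y
  proof (cases "y \<in> range xpt")
    case True
    then have "xpt (SOME e. xpt e = y) = y"
      by (auto intro: someI_ex)
    then show ?thesis
      using h(1) that C(2) unfolding A_def by (metis image_eqI restrict_apply' subsetD)
  next
    case False
    then show ?thesis
      using h(2) that C(2) by (auto simp: pts_def)
  qed
  ultimately show ?thesis by blast
qed

text \<open>
  On a finite set the values are bounded, so they can be rescaled to the unit interval.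
\<close>

lemma finite_real_extension:
  assumes C: "finite C" "C \<subseteq> pts"
  shows "\<exists>h\<in>baire_one_functions X euclideanreal. \<forall>y\<in>C. h y = f y"
proof -
  obtain M where M: "M > 0" "\<And>y. y \<in> C \<Longrightarrow> \<bar>f y\<bar> \<le> M"
  proof
    show "1 + (\<Sum>y\<in>C. \<bar>f y\<bar>) > 0"
      by (smt (verit) sum_nonneg abs_ge_zero)
    show "\<bar>f y\<bar> \<le> 1 + (\<Sum>y\<in>C. \<bar>f y\<bar>)" if "y \<in> C" for y
      using member_le_sum[of y C "\<lambda>y. \<bar>f y\<bar>"] that C(1) by simp
  qed
  define f' where "f' = (\<lambda>y. max 0 (min 1 (f y / (2 * M) + 1 / 2)))"
  obtain h where h: "h \<in> baire_one_functions X (top_of_set {0..1})" "\<forall>y\<in>C. h y = f' y"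
    using countable_unit_extension[OF countable_finite[OF C(1)] C(2), of f'] by (auto simp: f'_def)
  obtain F where F: "\<And>n. continuous_on pts (F n)" "\<And>y. y \<in> pts \<Longrightarrow> (\<lambda>n. F n y) \<longlonglongrightarrow> h y"
    using h(1) by (simp add: baire_one_functions_def limitin_subtopology continuous_map_in_subtopology)
      blast
  have "continuous_on pts (\<lambda>y. 2 * M * (F n y - 1 / 2))" for n
    by (intro continuous_intros F)
  moreover have "(\<lambda>n. 2 * M * (F n y - 1 / 2)) \<longlonglongrightarrow> 2 * M * (h y - 1 / 2)" if "y \<in> pts" for y
    by (intro tendsto_intros F that)
  ultimately have "restrict (\<lambda>y. 2 * M * (h y - 1 / 2)) pts \<in> baire_one_functions X euclideanreal"
    by (simp add: baire_one_functions_def exI[of _ "\<lambda>n y. 2 * M * (F n y - 1 / 2)"])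
  moreover have "2 * M * (h y - 1 / 2) = f y" if "y \<in> C" for y
  proof -
    have "0 \<le> f y / (2 * M) + 1 / 2" "f y / (2 * M) + 1 / 2 \<le> 1"
      using M(1) M(2)[OF that] by (auto simp: field_simps abs_le_iff)
    then have "h y = f y / (2 * M) + 1 / 2"
      using h(2) that by (simp add: f'_def)
    then show ?thesis using M(1) by simp
  qed
  ultimately show ?thesis
    using C(2) by (intro bexI[of _ "restrict (\<lambda>y. 2 * M * (h y - 1 / 2)) pts"]) auto
qed

end

section \<open>The game and the topology of pointwise convergence\<close>

text \<open>
  A position with player I to move, in which player II has followed \<open>\<sigma>\<close>.
\<close>

definition partial_play :: "'a topology \<Rightarrow> ('a set list \<Rightarrow> 'a set) \<Rightarrow> 'a set list \<Rightarrow> bool" where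
  "partial_play Z \<sigma> p \<longleftrightarrow> game_position Z p \<and> even (length p) \<and>
     (\<forall>n. 2 * n + 1 < length p \<longrightarrow> p ! (2 * n + 1) = \<sigma> (take (2 * n + 1) p))"

lemma game_position_snoc:
  assumes "game_position Z p" "openin Z V" "V \<noteq> {}" "p \<noteq> [] \<Longrightarrow> V \<subseteq> last p"
  shows "game_position Z (p @ [V])"
  unfolding game_position_def
proof (intro conjI allI impI)
  fix i
  show "openin Z ((p @ [V]) ! i)" "(p @ [V]) ! i \<noteq> {}" if "i < length (p @ [V])"
    using that assms(1-3) by (auto simp: game_position_def nth_append less_Suc_eq)
  show "(p @ [V]) ! Suc i \<subseteq> (p @ [V]) ! i" if "Suc i < length (p @ [V])"
  proof (cases "Suc i < length p")
    case True
    then show ?thesis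
      using assms(1) by (auto simp: game_position_def nth_append)
  next
    case False
    then have "Suc i = length p" using that by simp
    moreover from this have "p \<noteq> []" by auto
    ultimately show ?thesis
      using assms(4) by (simp add: nth_append last_conv_nth flip: \<open>Suc i = length p\<close>)
  qed
qed

lemma partial_play_extend:
  assumes \<sigma>: "strategy_II Z \<sigma>" and p: "partial_play Z \<sigma> p"
    and V: "openin Z V" "V \<noteq> {}" "p \<noteq> [] \<Longrightarrow> V \<subseteq> last p"
  defines "W \<equiv> \<sigma> (p @ [V])"
  shows "partial_play Z \<sigma> (p @ [V, W])" "openin Z W" "W \<noteq> {}"
proof -
  have pV: "game_position Z (p @ [V])"
    using p V by (intro game_position_snoc) (auto simp: partial_play_def)
  have "odd (length (p @ [V]))"
    using p by (simp add: partial_play_def)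
  then have W: "openin Z W" "W \<noteq> {}" "W \<subseteq> V"
    using \<sigma> pV unfolding strategy_II_def W_def by fastforce+
  then show "openin Z W" "W \<noteq> {}" by blast+
  have "game_position Z ((p @ [V]) @ [W])"
    using W by (intro game_position_snoc[OF pV]) simp_all
  moreover have "(p @ [V, W]) ! (2 * n + 1) = \<sigma> (take (2 * n + 1) (p @ [V, W]))"
    if n: "2 * n + 1 < length (p @ [V, W])" for n
  proof (cases "2 * n + 1 < length p")
    case True
    then show ?thesis
      using p by (simp add: partial_play_def nth_append)
  next
    case False
    moreover have "even (length p)" using p by (simp add: partial_play_def)
    ultimately have "2 * n = length p"
      using n by (auto elim!: evenE)
    then show ?thesis
      by (simp add: nth_append W_def)
  qed
  ultimately show "partial_play Z \<sigma> (p @ [V, W])"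
    using p by (simp add: partial_play_def)
qed

text \<open>
  A chain of positions, each one round longer than the preceding one, is an infinite play.
\<close>

lemma winning_strategy_limit:
  assumes \<sigma>: "winning_strategy_II Z \<sigma>" and q0: "q 0 = []"
    and q: "\<And>n. partial_play Z \<sigma> (q n)" and step: "\<And>n. \<exists>V W. q (Suc n) = q n @ [V, W]"
  shows "\<exists>z. \<forall>n. \<forall>U\<in>set (q n). z \<in> U"
proof -
  have len: "length (q n) = 2 * n" for n
  proof (induction n)
    case (Suc n)
    then show ?case using step[of n] by auto
  qed (simp add: q0)
  have prefix: "i < length (q n) \<Longrightarrow> q (n + m) ! i = q n ! i" for i n m
  proof (induction m)
    case (Suc m)
    obtain V W where "q (n + Suc m) = q (n + m) @ [V, W]"
      using step[of "n + m"] by auto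
    moreover have "i < length (q (n + m))"
      using Suc.prems by (simp add: len)
    ultimately show ?case
      using Suc by (simp add: nth_append)
  qed simp
  define V where "V = (\<lambda>i. q (Suc i) ! i)"
  have V: "q n ! i = V i" if "i < length (q n)" for n i
    using prefix[OF that, of "Suc i"] prefix[of i "Suc i" n] len[of "Suc i"]
    by (simp add: V_def add.commute)
  have play: "game_play Z V"
    unfolding game_play_def
  proof
    fix n
    have "game_position Z (q (Suc (Suc n)))"
      using q by (simp add: partial_play_def)
    then have "openin Z (q (Suc (Suc n)) ! n) \<and> q (Suc (Suc n)) ! n \<noteq> {} \<and>
        q (Suc (Suc n)) ! Suc n \<subseteq> q (Suc (Suc n)) ! n"
      by (simp add: game_position_def len)
    then show "openin Z (V n) \<and> V n \<noteq> {} \<and> V (Suc n) \<subseteq> V n"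
      by (simp add: V len)
  qed
  have V\<sigma>: "V (2 * n + 1) = \<sigma> (map V [0..<2 * n + 1])" for n
  proof -
    have "take (2 * n + 1) (q (Suc n)) = map V [0..<2 * n + 1]"
      by (rule nth_equalityI) (simp_all add: len V del: upt_Suc)
    moreover have "q (Suc n) ! (2 * n + 1) = \<sigma> (take (2 * n + 1) (q (Suc n)))"
      using q[of "Suc n"] by (simp add: partial_play_def len)
    ultimately show ?thesis
      using V[of "2 * n + 1" "Suc n"] by (simp add: len)
  qed
  have "game_play Z V \<and> (\<forall>n. V (2 * n + 1) = \<sigma> (map V [0..<2 * n + 1])) \<longrightarrow> (\<Inter>n. V n) \<noteq> {}"
    using \<sigma> unfolding winning_strategy_II_def by (elim conjE allE)
  then have "(\<Inter>n. V n) \<noteq> {}"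
    using play V\<sigma> by blast
  then obtain z where z: "\<And>n. z \<in> V n"
    by blast
  have "z \<in> U" if "U \<in> set (q n)" for U n
    using that z V unfolding in_set_conv_nth by auto
  then show ?thesis by blast
qed

lemma baire_one_functions_subset: "baire_one_functions X Y \<subseteq> topspace X \<rightarrow>\<^sub>E topspace Y"
  by (auto simp: baire_one_functions_def)

lemma topspace_baire_one_space: "topspace (baire_one_space X Y) = baire_one_functions X Y"
  using baire_one_functions_subset[of X Y] by (auto simp: baire_one_space_def)

lemma openin_baire_one_box:
  assumes K: "finite K" "K \<subseteq> topspace X" and B: "\<And>y. y \<in> K \<Longrightarrow> openin Y (B y)"
  shows "openin (baire_one_space X Y) {h \<in> baire_one_functions X Y. \<forall>y\<in>K. h y \<in> B y}"
proof -
  let ?P = "Pi\<^sub>E (topspace X) (\<lambda>y. if y \<in> K then B y else topspace Y)"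
  have "openin (product_topology (\<lambda>_. Y) (topspace X)) ?P"
    unfolding openin_PiE_gen
  proof (intro disjI2 conjI ballI)
    show "finite {y \<in> topspace X. (if y \<in> K then B y else topspace Y) \<noteq> topspace Y}"
      by (rule finite_subset[OF _ K(1)]) auto
    show "openin Y (if y \<in> K then B y else topspace Y)" for y
      using B by simp
  qed
  moreover have "(\<forall>y\<in>K. h y \<in> B y) = (h \<in> ?P)" if "h \<in> baire_one_functions X Y" for h
  proof -
    have h: "h \<in> topspace X \<rightarrow>\<^sub>E topspace Y"
      using that baire_one_functions_subset[of X Y] by blast
    show ?thesis
    proof
      assume "\<forall>y\<in>K. h y \<in> B y"
      then show "h \<in> ?P" using h by (simp add: PiE_iff)
    next
      assume P: "h \<in> ?P"
      show "\<forall>y\<in>K. h y \<in> B y"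
      proof
        fix y assume "y \<in> K"
        then show "h y \<in> B y" using PiE_mem[OF P, of y] K(2) by auto
      qed
    qed
  qed
  then have "{h \<in> baire_one_functions X Y. \<forall>y\<in>K. h y \<in> B y} = ?P \<inter> baire_one_functions X Y"
    by blast
  ultimately show ?thesis
    unfolding baire_one_space_def openin_subtopology by blast
qed

lemma openin_baire_one_contains_box:
  assumes U: "openin (baire_one_space X Y) U" and f: "f \<in> U"
  shows "\<exists>K B. finite K \<and> K \<subseteq> topspace X \<and> (\<forall>y\<in>K. openin Y (B y) \<and> f y \<in> B y) \<and>
    (\<forall>h\<in>baire_one_functions X Y. (\<forall>y\<in>K. h y \<in> B y) \<longrightarrow> h \<in> U)"
proof -
  obtain T where T: "openin (product_topology (\<lambda>_. Y) (topspace X)) T" "U = T \<inter> baire_one_functions X Y"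
    using U unfolding baire_one_space_def openin_subtopology by blast
  then obtain B where B: "f \<in> Pi\<^sub>E (topspace X) B" "\<And>y. openin Y (B y)"
    "finite {y. B y \<noteq> topspace Y}" "Pi\<^sub>E (topspace X) B \<subseteq> T"
    using f product_topology_open_contains_basis[OF T(1), of f] by auto
  define K where "K = {y \<in> topspace X. B y \<noteq> topspace Y}"
  have "h \<in> U" if "h \<in> baire_one_functions X Y" "\<forall>y\<in>K. h y \<in> B y" for h
  proof -
    have h: "h \<in> topspace X \<rightarrow>\<^sub>E topspace Y"
      using that(1) baire_one_functions_subset[of X Y] by blast
    then have "h y \<in> B y" if "y \<in> topspace X" for y
      using that \<open>\<forall>y\<in>K. h y \<in> B y\<close> by (cases "y \<in> K") (auto simp: K_def)
    then have "h \<in> Pi\<^sub>E (topspace X) B"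
      using h by (simp add: PiE_iff)
    then show ?thesis
      using B(4) T(2) that(1) by blast
  qed
  moreover have "finite K"
    by (rule finite_subset[OF _ B(3)]) (auto simp: K_def)
  moreover have "K \<subseteq> topspace X" "\<forall>y\<in>K. openin Y (B y) \<and> f y \<in> B y"
    using B(1,2) by (auto simp: K_def)
  ultimately show ?thesis by blast
qed

section \<open>Topological properties of the space\<close>

context saturated_incidence
begin

lemma Hausdorff_X: "Hausdorff_space X"
proof -
  have "Hausdorff_space (product_topology (\<lambda>_. euclideanreal) (UNIV :: real set))"
    by (simp add: Hausdorff_space_product_topology)
  then show ?thesis
    by (simp add: euclidean_product_topology Hausdorff_space_subtopology)
qed

lemma completely_regular_X: "completely_regular_space X"
proof -
  have "completely_regular_space (product_topology (\<lambda>_. euclideanreal) (UNIV :: real set))"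
    by (simp add: completely_regular_space_product_topology metrizable_imp_completely_regular_space
      metrizable_space_euclidean)
  then show ?thesis
    by (simp add: euclidean_product_topology completely_regular_space_subtopology)
qed

lemma dpt_in_cylinder_around:
  assumes "finite K" "finite N" "y \<in> pts"
  shows "\<exists>k. k \<notin> N \<and> (\<forall>g\<in>K. dpt k g = y g)"
  using dpt_in_cylinder[OF assms(1) finite_null[of "insert 0 N"], of y] assms(2) pts_01[OF assms(3)]
  by auto

lemma separable_X: "separable_space X"
  unfolding separable_space_def
proof (intro exI conjI)
  show "countable (range dpt)" by simp
  show "range dpt \<subseteq> topspace X" by auto
  have "y \<in> X closure_of range dpt" if y: "y \<in> pts" for y
    unfolding in_closure_of
  proof (intro conjI allI impI)
    show "y \<in> topspace X" using y by simp
    fix T assume T: "y \<in> T \<and> openin X T"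
    then obtain U where U: "open U" "T = pts \<inter> U"
      unfolding openin_open by blast
    then obtain K where K: "finite K" "\<And>z. \<forall>i\<in>K. z i = y i \<Longrightarrow> z \<in> U"
      using open_contains_cylinder[of U y] T by blast
    obtain k where "\<forall>g\<in>K. dpt k g = y g"
      using dpt_in_cylinder_around[OF K(1) finite.emptyI y] by blast
    then show "\<exists>z. z \<in> range dpt \<and> z \<in> T"
      using K(2) U(2) by (intro exI[of _ "dpt k"]) simp
  qed
  then show "X closure_of range dpt = topspace X"
    using closure_of_subset_topspace[of X "range dpt"] by auto
qed

lemma continuous_preimage_cylinder:
  fixes F :: "(real \<Rightarrow> real) \<Rightarrow> 'b :: topological_space"
  assumes "continuous_on pts F" "y \<in> pts" "open B" "F y \<in> B"
  shows "\<exists>K. finite K \<and> (\<forall>z\<in>pts. (\<forall>i\<in>K. z i = y i) \<longrightarrow> F z \<in> B)"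
proof -
  obtain U where U: "open U" "y \<in> U" "\<forall>z\<in>pts. z \<in> U \<longrightarrow> F z \<in> B"
    using assms unfolding continuous_on_topological by blast
  obtain K where "finite K" "\<And>z. \<forall>i\<in>K. z i = y i \<Longrightarrow> z \<in> U"
    using open_contains_cylinder[OF U(1,2)] by blast
  then show ?thesis
    using U(3) by blast
qed

text \<open>
  A strict lower bound for the absolute value of a continuous function persists on a cylinder.
\<close>

lemma large_values_cylinder:
  assumes F: "continuous_on pts (F :: _ \<Rightarrow> real)" and y: "y \<in> pts" and c: "c < \<bar>F y\<bar>"
  shows "\<exists>K. finite K \<and> (\<forall>z\<in>pts. (\<forall>i\<in>K. z i = y i) \<longrightarrow> c < \<bar>F z\<bar>)"
proof -
  have "continuous_on pts (\<lambda>z. \<bar>F z\<bar>)"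
    using F by (intro continuous_intros)
  from continuous_preimage_cylinder[OF this y, of "{c<..}"] c show ?thesis
    by simp
qed

lemma cluster_pattern:
  fixes k :: "nat \<Rightarrow> nat"
  shows "\<exists>q. \<forall>K m. finite K \<longrightarrow> (\<exists>n\<ge>m. \<forall>g\<in>K. dpt (k n) g = q g)"
proof -
  have d01: "dpt i g \<in> {0, 1}" for i g
    by (rule pts_01[OF dpt_in_pts])
  have "dpt (k n) g \<in> {0..1}" for n g
    using d01[of "k n" g] by auto
  from bounded_sequence_cluster_function[of "\<lambda>n. dpt (k n)", OF this]
  obtain q where q: "\<forall>K m e. finite K \<longrightarrow> e > 0 \<longrightarrow> (\<exists>n\<ge>m. \<forall>i\<in>K. \<bar>dpt (k n) i - q i\<bar> < e)"
    by (elim exE conjE)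
  define r :: "real \<Rightarrow> real" where "r = (\<lambda>g. of_bool (q g > 1 / 2))"
  have "\<exists>n\<ge>m. \<forall>g\<in>K. dpt (k n) g = r g" if K: "finite K" for K m
  proof -
    obtain n where n: "n \<ge> m" "\<forall>g\<in>K. \<bar>dpt (k n) g - q g\<bar> < 1 / 2"
      using q[rule_format, OF K, of "1 / 2" m] by auto
    have "dpt (k n) g = r g" if "g \<in> K" for g
    proof -
      have "\<bar>dpt (k n) g - q g\<bar> < 1 / 2"
        using n(2) that by blast
      then show ?thesis
        using d01[of "k n" g] by (auto simp: r_def)
    qed
    then show ?thesis using n(1) by blast
  qed
  then show ?thesis by blast
qed

text \<open>
  If \<open>f\<close> is unbounded, then for each \<open>n\<close> its absolute value exceeds \<open>n\<close> on a cylinder around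
  a point \<open>d (k n)\<close> with support \<open>K n\<close>. Let \<open>q\<close> be a cluster point of these points in the cube.
  Some point of \<open>E\<close> agrees with \<open>q\<close> on the countable union \<open>J\<close> of the supports. Each neighbourhood
  of this point meets infinitely many of the cylinders, since coordinates outside \<open>J\<close> are
  free, so that \<open>f\<close> is unbounded near it.
\<close>

lemma pseudocompact_X: "pseudocompact_space X"
  unfolding pseudocompact_space_def
proof (intro allI impI, rule ccontr)
  fix f assume "continuous_map X euclideanreal f" and unb: "\<not> bounded (f ` topspace X)"
  then have f: "continuous_on pts f" by simp
  have "\<forall>n. \<exists>kK. finite (snd kK) \<and>
    (\<forall>z\<in>pts. (\<forall>i\<in>snd kK. z i = dpt (fst kK) i) \<longrightarrow> real n < \<bar>f z\<bar>)"
  proof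
    fix n
    have "\<exists>y\<in>pts. real n < \<bar>f y\<bar>"
      using unb unfolding bounded_iff by (auto simp: not_le)
    then obtain y where y: "y \<in> pts" "real n < \<bar>f y\<bar>" by blast
    obtain K where K: "finite K" "\<forall>z\<in>pts. (\<forall>i\<in>K. z i = y i) \<longrightarrow> real n < \<bar>f z\<bar>"
      using large_values_cylinder[OF f y] by blast
    obtain k where "\<forall>g\<in>K. dpt k g = y g"
      using dpt_in_cylinder_around[OF K(1) finite.emptyI y(1)] by blast
    then show "\<exists>kK. finite (snd kK) \<and>
        (\<forall>z\<in>pts. (\<forall>i\<in>snd kK. z i = dpt (fst kK) i) \<longrightarrow> real n < \<bar>f z\<bar>)"
      using K by (intro exI[of _ "(k, K)"]) simp
  qed
  from choice[OF this] obtain kK where kK: "\<forall>n. finite (snd (kK n)) \<and>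
    (\<forall>z\<in>pts. (\<forall>i\<in>snd (kK n). z i = dpt (fst (kK n)) i) \<longrightarrow> real n < \<bar>f z\<bar>)"
    by (elim exE)
  define k where "k = (\<lambda>n. fst (kK n))"
  define K where "K = (\<lambda>n. snd (kK n))"
  have K: "finite (K n)" and large: "z \<in> pts \<Longrightarrow> \<forall>i\<in>K n. z i = dpt (k n) i \<Longrightarrow> real n < \<bar>f z\<bar>" for n z
    using kK unfolding K_def k_def by blast+
  define J where "J = (\<Union>n. K n)"
  have J: "countable J" unfolding J_def using K by (intro countable_UN) (auto intro: countable_finite)
  obtain q where q: "\<forall>K m. finite K \<longrightarrow> (\<exists>n\<ge>m. \<forall>g\<in>K. dpt (k n) g = q g)"
    using cluster_pattern[of k] by (elim exE)
  have q01: "q g \<in> {0, 1}" for g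
  proof -
    obtain n where "dpt (k n) g = q g" using q[rule_format, of "{g}"] by auto
    then show ?thesis using pts_01[OF dpt_in_pts, of "k n" g] by simp
  qed
  obtain e where e: "\<forall>g\<in>J. xpt e g = q g"
    using xpt_realizes[OF J, of q] q01 by blast
  let ?y = "xpt e"
  have "f ?y \<in> ball (f ?y) 1" by simp
  then obtain L where L: "finite L" "\<And>z. z \<in> pts \<Longrightarrow> \<forall>i\<in>L. z i = ?y i \<Longrightarrow> f z \<in> ball (f ?y) 1"
    using continuous_preimage_cylinder[OF f xpt_in_pts open_ball, of e "f ?y" 1] by blast
  obtain m :: nat where m: "\<bar>f ?y\<bar> + 1 \<le> real m"
    using real_arch_simple by blast
  obtain n where n: "n \<ge> m" "\<forall>g\<in>L \<inter> J. dpt (k n) g = q g"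
    using q[rule_format, of "L \<inter> J" m] L(1) by blast
  define p where "p = (\<lambda>g. if g \<in> J then dpt (k n) g else ?y g)"
  have "p g \<in> {0, 1}" for g
    using pts_01[OF dpt_in_pts, of "k n"] pts_01[OF xpt_in_pts, of e] by (simp add: p_def)
  then obtain i where i: "\<forall>g\<in>K n \<union> L. dpt i g = p g"
    using dpt_in_cylinder[OF _ null_singleton, of "K n \<union> L" p] K[of n] L(1) by blast
  have "\<forall>g\<in>K n. dpt i g = dpt (k n) g"
    using i by (auto simp: p_def J_def)
  then have "real n < \<bar>f (dpt i)\<bar>"
    by (rule large[OF dpt_in_pts])
  moreover have "f (dpt i) \<in> ball (f ?y) 1"
    using i n(2) e by (intro L(2)) (auto simp: p_def)
  ultimately show False
    using m n(1) by (auto simp: dist_real_def)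
qed

text \<open>
  The Baire category argument. Suppose that the absolute value of \<open>h\<close> tends to infinity along \<open>D\<close>. The closed sets where
  all \<open>F i\<close> are bounded by \<open>n\<close> contain only finitely many points of \<open>D\<close>, so they have empty
  interior, as every nonempty open set contains infinitely many points of \<open>D\<close>. A decreasing sequence
  of cylinders successively avoids them. Together the cylinders restrict countably many
  coordinates only, so a point of \<open>E\<close> lies in all of them, and there the sequence \<open>F\<close> is unbounded.
\<close>

lemma baire_one_not_divergent:
  assumes F: "\<And>n. continuous_on pts (F n :: _ \<Rightarrow> real)"
    and lim: "\<And>y. y \<in> pts \<Longrightarrow> (\<lambda>n. F n y) \<longlonglongrightarrow> h y"
  shows "\<exists>m :: nat. infinite {k. \<bar>h (dpt k)\<bar> \<le> real m}"
proof (rule ccontr)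
  assume "\<not> ?thesis"
  then have fin: "finite {k. \<bar>h (dpt k)\<bar> \<le> real m}" for m :: nat by blast
  have escape: "\<exists>n. real m < \<bar>F n (dpt k)\<bar>" if "real m < \<bar>h (dpt k)\<bar>" for m k
  proof (rule ccontr)
    assume "\<nexists>n. real m < \<bar>F n (dpt k)\<bar>"
    then have "\<bar>h (dpt k)\<bar> \<le> real m"
      by (intro LIMSEQ_le_const2[OF tendsto_rabs[OF lim[OF dpt_in_pts]]]) (auto simp: not_less)
    then show False using that by simp
  qed
  define Q :: "nat \<Rightarrow> nat \<times> real set \<Rightarrow> nat \<times> real set \<Rightarrow> bool" where
    "Q = (\<lambda>n t t'. snd t \<subseteq> snd t' \<and> (\<forall>g\<in>snd t. dpt (fst t') g = dpt (fst t) g) \<and>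
       (\<forall>z\<in>pts. (\<forall>g\<in>snd t'. z g = dpt (fst t') g) \<longrightarrow> (\<exists>i. real n < \<bar>F i z\<bar>)))"
  have "\<exists>s. \<forall>n. finite (snd (s n)) \<and> Q n (s n) (s (Suc n))"
  proof (rule dependent_nat_choice[of "\<lambda>_ t. finite (snd t)" Q])
    show "\<exists>t :: nat \<times> real set. finite (snd t)"
      by (intro exI[of _ "(0, {})"]) simp
    fix t :: "nat \<times> real set" and n :: nat assume t: "finite (snd t)"
    obtain k where k: "k \<notin> {k. \<bar>h (dpt k)\<bar> \<le> real n}" "\<forall>g\<in>snd t. dpt k g = dpt (fst t) g"
      using dpt_in_cylinder_around[OF t fin[of n] dpt_in_pts[of "fst t"]] by blast
    from k(1) have "real n < \<bar>h (dpt k)\<bar>" by simp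
    then obtain i where i: "real n < \<bar>F i (dpt k)\<bar>"
      using escape[of n k] by blast
    obtain K where "finite K" "\<forall>z\<in>pts. (\<forall>g\<in>K. z g = dpt k g) \<longrightarrow> real n < \<bar>F i z\<bar>"
      using large_values_cylinder[of "F i" "dpt k" "real n", OF F dpt_in_pts i] by blast
    then show "\<exists>t'. finite (snd t') \<and> Q n t t'"
      using t k(2) unfolding Q_def by (intro exI[of _ "(k, snd t \<union> K)"]) auto
  qed
  then obtain s where s: "\<forall>n. finite (snd (s n)) \<and> Q n (s n) (s (Suc n))"
    by (elim exE)
  then have fin_s: "finite (snd (s n))" and mono: "snd (s n) \<subseteq> snd (s (Suc n))"
    and agree: "g \<in> snd (s n) \<Longrightarrow> dpt (fst (s (Suc n))) g = dpt (fst (s n)) g"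
    and big: "z \<in> pts \<Longrightarrow> \<forall>g\<in>snd (s (Suc n)). z g = dpt (fst (s (Suc n))) g \<Longrightarrow>
      \<exists>i. real n < \<bar>F i z\<bar>" for n g z
    unfolding Q_def by blast+
  have later: "g \<in> snd (s (n + j)) \<and> dpt (fst (s (n + j))) g = dpt (fst (s n)) g" if "g \<in> snd (s n)" for n j g
    by (induction j) (use that mono agree in auto)
  define J where "J = (\<Union>n. snd (s n))"
  have J: "countable J" unfolding J_def using fin_s by (intro countable_UN) (auto intro: countable_finite)
  define p where "p = (\<lambda>g. dpt (fst (s (LEAST n. g \<in> snd (s n)))) g)"
  have p: "p g = dpt (fst (s n)) g" if "g \<in> snd (s n)" for g n
  proof -
    let ?l = "LEAST n. g \<in> snd (s n)"
    have "g \<in> snd (s ?l)" "?l \<le> n"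
      using that by (auto intro: LeastI Least_le)
    then show ?thesis
      using later[of g ?l "n - ?l"] by (simp add: p_def)
  qed
  obtain e where e: "\<forall>g\<in>J. xpt e g = p g"
    using xpt_realizes[OF J, of p] pts_01[OF dpt_in_pts] by (auto simp: p_def)
  have unbounded: "\<exists>i. real n < \<bar>F i (xpt e)\<bar>" for n
    using e p by (intro big) (auto simp: J_def)
  have "Bseq (\<lambda>i. F i (xpt e))"
    using lim[OF xpt_in_pts] convergentI convergent_imp_Bseq by blast
  then obtain B where "\<And>i. \<bar>F i (xpt e)\<bar> \<le> B"
    unfolding Bseq_def by auto
  moreover obtain n :: nat where "B \<le> real n"
    using real_arch_simple by blast
  ultimately show False
    using unbounded[of n] by (meson not_less order_trans)
qed

end

section \<open>The unit-interval-valued functions form a Choquet space\<close>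

context saturated_incidence
begin

text \<open>
  Player II answers \<open>U\<close> by an open box whose closed version is contained in \<open>U\<close>. The centres of
  the boxes have a cluster point, which lies in all the closed boxes; only its values at
  the countably many points that occur in the boxes matter, and these values
  extend to a Baire-one function.
\<close>

lemma choquet_unit_interval: "choquet_space (baire_one_space X (top_of_set {0..1::real}))"
proof -
  let ?Z = "baire_one_space X (top_of_set {0..1::real})"
  let ?B = "baire_one_functions X (top_of_set {0..1::real})"
  have top: "topspace ?Z = ?B"
    by (rule topspace_baire_one_space)
  have vals: "h y \<in> {0..1}" if "h \<in> ?B" "y \<in> pts" for h y
  proof -
    have "h \<in> topspace X \<rightarrow>\<^sub>E topspace (top_of_set {0..1::real})"
      using that(1) baire_one_functions_subset by blast
    from PiE_mem[OF this, of y] that(2) show ?thesis by simp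
  qed
  have "\<forall>U. \<exists>t. openin ?Z U \<and> U \<noteq> {} \<longrightarrow> (case t of (f, K, e) \<Rightarrow>
      f \<in> ?B \<and> finite K \<and> K \<subseteq> pts \<and> e > (0 :: real) \<and>
      (\<forall>h\<in>?B. (\<forall>y\<in>K. \<bar>h y - f y\<bar> \<le> e) \<longrightarrow> h \<in> U))"
  proof
    fix U
    show "\<exists>t. openin ?Z U \<and> U \<noteq> {} \<longrightarrow> (case t of (f, K, e) \<Rightarrow>
      f \<in> ?B \<and> finite K \<and> K \<subseteq> pts \<and> e > (0 :: real) \<and>
      (\<forall>h\<in>?B. (\<forall>y\<in>K. \<bar>h y - f y\<bar> \<le> e) \<longrightarrow> h \<in> U))"
    proof (cases "openin ?Z U \<and> U \<noteq> {}")
      case True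
      then obtain f where f: "f \<in> U" by blast
      have fB: "f \<in> ?B"
        using f True openin_subset[of ?Z U] unfolding top by blast
      obtain K B where K: "finite K" "K \<subseteq> pts"
        and B: "\<forall>y\<in>K. openin (top_of_set {0..1::real}) (B y) \<and> f y \<in> B y"
        and KB: "\<forall>h\<in>?B. (\<forall>y\<in>K. h y \<in> B y) \<longrightarrow> h \<in> U"
        using openin_baire_one_contains_box[OF _ f, of X "top_of_set {0..1::real}"] True by auto
      have "\<forall>y. \<exists>e. y \<in> K \<longrightarrow> e > 0 \<and> (\<forall>v\<in>{0..1}. \<bar>v - f y\<bar> \<le> e \<longrightarrow> v \<in> B y)"
      proof
        fix y
        show "\<exists>e. y \<in> K \<longrightarrow> e > 0 \<and> (\<forall>v\<in>{0..1}. \<bar>v - f y\<bar> \<le> e \<longrightarrow> v \<in> B y)"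
        proof (cases "y \<in> K")
          case True
          then obtain e where "e > 0" "ball (f y) e \<inter> {0..1} \<subseteq> B y"
            using B unfolding openin_contains_ball by blast
          then show ?thesis
            by (intro exI[of _ "e / 2"]) (auto simp: subset_iff dist_real_def abs_minus_commute)
        qed simp
      qed
      from choice[OF this] obtain \<epsilon> where
        \<epsilon>: "\<forall>y. y \<in> K \<longrightarrow> \<epsilon> y > 0 \<and> (\<forall>v\<in>{0..1}. \<bar>v - f y\<bar> \<le> \<epsilon> y \<longrightarrow> v \<in> B y)"
        by (elim exE)
      define e where "e = Min (insert 1 (\<epsilon> ` K))"
      have e: "e > 0" "\<And>y. y \<in> K \<Longrightarrow> e \<le> \<epsilon> y"
        using K(1) \<epsilon> by (auto simp: e_def)
      have "h \<in> U" if h: "h \<in> ?B" "\<forall>y\<in>K. \<bar>h y - f y\<bar> \<le> e" for h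
      proof -
        have "h y \<in> B y" if "y \<in> K" for y
          using \<epsilon> e(2)[OF that] h(2) that vals[OF h(1), of y] K(2) by force
        then show ?thesis using KB h(1) by blast
      qed
      then show ?thesis
        using fB K e(1) by (intro exI[of _ "(f, K, e)"]) simp
    next
      case False
      then show ?thesis by blast
    qed
  qed
  from choice[OF this] obtain c where c: "\<forall>U. openin ?Z U \<and> U \<noteq> {} \<longrightarrow> (case c U of (f, K, e) \<Rightarrow>
      f \<in> ?B \<and> finite K \<and> K \<subseteq> pts \<and> e > (0 :: real) \<and>
      (\<forall>h\<in>?B. (\<forall>y\<in>K. \<bar>h y - f y\<bar> \<le> e) \<longrightarrow> h \<in> U))"
    by (elim exE)
  define f where "f = (\<lambda>U. fst (c U))"
  define K where "K = (\<lambda>U. fst (snd (c U)))"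
  define e where "e = (\<lambda>U. snd (snd (c U)))"
  have f: "f U \<in> ?B" and K: "finite (K U)" "K U \<subseteq> pts" and e: "e U > 0"
    and KU: "\<And>h. h \<in> ?B \<Longrightarrow> \<forall>y\<in>K U. \<bar>h y - f U y\<bar> \<le> e U \<Longrightarrow> h \<in> U"
    if "openin ?Z U \<and> U \<noteq> {}" for U
    using c[rule_format, OF that] by (auto simp: f_def K_def e_def case_prod_unfold)
  define box where "box = (\<lambda>U. {h \<in> ?B. \<forall>y\<in>K U. h y \<in> {0..1} \<inter> ball (f U y) (e U)})"
  define \<sigma> where "\<sigma> = (\<lambda>p. box (last p))"
  have box: "openin ?Z (box U)" "f U \<in> box U" "box U \<subseteq> U"
    if U: "openin ?Z U \<and> U \<noteq> {}" for U
  proof -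
    show "openin ?Z (box U)"
      unfolding box_def using K[OF U] by (intro openin_baire_one_box) (auto intro: openin_open_Int)
    show "f U \<in> box U"
      using f[OF U] K[OF U] e[OF U] vals[OF f[OF U]] by (auto simp: box_def)
    show "box U \<subseteq> U"
      using KU[OF U] by (fastforce simp: box_def dist_real_def)
  qed
  have "strategy_II ?Z \<sigma>"
    unfolding strategy_II_def
  proof (intro allI impI)
    fix p assume p: "game_position ?Z p \<and> odd (length p)"
    then have "p \<noteq> []" by auto
    then have U: "openin ?Z (last p) \<and> last p \<noteq> {}"
      using p by (simp add: game_position_def last_conv_nth)
    show "openin ?Z (\<sigma> p) \<and> \<sigma> p \<noteq> {} \<and> \<sigma> p \<subseteq> last p"
      using box[OF U] by (auto simp: \<sigma>_def)
  qed
  moreover have "(\<Inter>n. V n) \<noteq> {}"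
    if play: "game_play ?Z V" and V\<sigma>: "\<forall>n. V (2 * n + 1) = \<sigma> (map V [0..<2 * n + 1])" for V
  proof -
    have V: "openin ?Z (V n) \<and> V n \<noteq> {}" and Vdec: "V (Suc n) \<subseteq> V n" for n
      using play by (auto simp: game_play_def)
    have Vmono: "V n \<subseteq> V m" if "m \<le> n" for m n
      by (rule lift_Suc_antimono_le[of V, OF Vdec that])
    have Vbox: "V (2 * n + 1) = box (V (2 * n))" for n
      using V\<sigma>[rule_format, of n] by (simp add: \<sigma>_def)
    define u where "u = (\<lambda>n y. if y \<in> pts then f (V (2 * n)) y else 0)"
    have u01: "u n y \<in> {0..1}" for n y
      using vals[OF f[OF V]] by (simp add: u_def)
    obtain q where q: "\<forall>i. q i \<in> {0..1}"
      "\<forall>L m \<delta>. finite L \<longrightarrow> \<delta> > 0 \<longrightarrow> (\<exists>n\<ge>m. \<forall>i\<in>L. \<bar>u n i - q i\<bar> < \<delta>)"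
      using bounded_sequence_cluster_function[of u, OF u01] by (elim exE conjE)
    define A where "A = (\<Union>n. K (V (2 * n)))"
    have A: "countable A" "A \<subseteq> pts"
      using K[OF V] by (auto simp: A_def intro: countable_finite)
    obtain h where h: "h \<in> ?B" "\<forall>y\<in>A. h y = q y"
      using countable_unit_extension[OF A, of q] q(1) by auto
    have "h \<in> V (2 * n)" for n
    proof (rule KU[OF V h(1)], intro ballI)
      fix y assume y: "y \<in> K (V (2 * n))"
      let ?U = "V (2 * n)"
      have yp: "y \<in> pts" using y K[OF V] by blast
      have "\<bar>q y - f ?U y\<bar> \<le> e ?U"
      proof (rule field_le_epsilon)
        fix \<delta> :: real assume "\<delta> > 0"
        then obtain m where m: "m \<ge> Suc n" "\<bar>u m y - q y\<bar> < \<delta>"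
          using q(2)[rule_format, of "{y}" \<delta> "Suc n"] by auto
        have "f (V (2 * m)) \<in> V (2 * m)"
          using box(2,3)[OF V] by blast
        moreover have "V (2 * m) \<subseteq> box ?U"
          using Vmono[of "2 * n + 1" "2 * m"] m(1) Vbox[of n] by simp
        ultimately have "f (V (2 * m)) \<in> box ?U" by blast
        then have "\<bar>f (V (2 * m)) y - f ?U y\<bar> < e ?U"
          using y by (auto simp: box_def dist_real_def abs_minus_commute)
        then show "\<bar>q y - f ?U y\<bar> \<le> e ?U + \<delta>"
          using m(2) yp by (simp add: u_def)
      qed
      then show "\<bar>h y - f ?U y\<bar> \<le> e ?U"
        using h(2) y by (auto simp: A_def)
    qed
    then have "h \<in> V n" for n
      using Vmono[of n "2 * n"] by auto
    then show ?thesis by blast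
  qed
  ultimately show ?thesis
    unfolding choquet_space_def winning_strategy_II_def by blast
qed

end

section \<open>The real-valued functions do not form a Choquet space\<close>

context saturated_incidence
begin

lemma inj_dpt: "inj dpt"
proof (rule injI, rule ccontr)
  fix k i assume eq: "dpt k = dpt i" and "k \<noteq> i"
  have "{k, i} \<in> null"
    by (rule finite_null) auto
  then obtain g where "\<forall>j\<in>{k, i}. d j g = (j = k)"
    using interpolating_coordinate[OF countable_empty, of "{k, i}" undefined "\<lambda>j. j = k"] by blast
  moreover have "d k g = d i g"
    using eq dpt_eq_iff by metis
  ultimately show False
    using \<open>k \<noteq> i\<close> by simp
qed

abbreviation "\<B> \<equiv> baire_one_functions X euclideanreal"

text \<open>
  Prescribing suitable values at the points of \<open>K\<close> forces a Baire-one function into \<open>U\<close>. It leaves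
  the values at all other points free, so these can still be made large.
\<close>

definition pins :: "(real \<Rightarrow> real) set \<Rightarrow> ((real \<Rightarrow> real) \<Rightarrow> real) set \<Rightarrow> bool" where
  "pins K U \<longleftrightarrow> finite K \<and> K \<subseteq> pts \<and> (\<exists>f. \<forall>h\<in>\<B>. (\<forall>y\<in>K. h y = f y) \<longrightarrow> h \<in> U)"

lemma open_set_pinned:
  assumes "openin (baire_one_space X euclideanreal) U" "U \<noteq> {}"
  shows "\<exists>K. pins K U"
proof -
  obtain f where f: "f \<in> U" using assms(2) by blast
  obtain K B where K: "finite K" "K \<subseteq> topspace X" "\<forall>y\<in>K. openin euclideanreal (B y) \<and> f y \<in> B y"
    "\<forall>h\<in>\<B>. (\<forall>y\<in>K. h y \<in> B y) \<longrightarrow> h \<in> U"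
    using openin_baire_one_contains_box[OF assms(1) f] by (elim exE conjE)
  have "h \<in> U" if "h \<in> \<B>" "\<forall>y\<in>K. h y = f y" for h
    using K(3,4) that by simp
  then show ?thesis
    using K(1,2) unfolding pins_def by (intro exI[of _ K] conjI exI[of _ f]) auto
qed

text \<open>
  The set in which player I has to move.
\<close>

definition region :: "((real \<Rightarrow> real) \<Rightarrow> real) set list \<Rightarrow> ((real \<Rightarrow> real) \<Rightarrow> real) set" where
  "region p = (if p = [] then \<B> else last p)"

text \<open>
  One round in which player I demands values above \<open>t\<close> on \<open>T\<close>.
\<close>

lemma push_values_up:
  assumes \<sigma>: "strategy_II (baire_one_space X euclideanreal) \<sigma>"
    and p: "partial_play (baire_one_space X euclideanreal) \<sigma> p"
    and K: "pins K (region p)" and T: "finite T" "T \<subseteq> pts" "T \<inter> K = {}"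
  shows "\<exists>V W L. partial_play (baire_one_space X euclideanreal) \<sigma> (p @ [V, W]) \<and>
    (\<forall>h\<in>V. \<forall>y\<in>T. t < h y) \<and> pins L (region (p @ [V, W]))"
proof -
  let ?Z = "baire_one_space X euclideanreal"
  have top: "topspace ?Z = \<B>"
    by (rule topspace_baire_one_space)
  define V where "V = region p \<inter> {h \<in> \<B>. \<forall>y\<in>T. h y \<in> {t<..}}"
  obtain f where f: "\<And>h. h \<in> \<B> \<Longrightarrow> \<forall>y\<in>K. h y = f y \<Longrightarrow> h \<in> region p"
    using K unfolding pins_def by blast
  have KT: "finite (K \<union> T)" "K \<union> T \<subseteq> pts"
    using K T unfolding pins_def by auto
  obtain h where h: "h \<in> \<B>" "\<forall>y\<in>K \<union> T. h y = (if y \<in> T then t + 1 else f y)"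
    using finite_real_extension[OF KT, of "\<lambda>y. if y \<in> T then t + 1 else f y"] by blast
  have "h \<in> region p"
    using T(3) h(2) by (intro f h(1)) auto
  then have ne: "V \<noteq> {}"
    using h by (auto simp: V_def)
  have reg: "openin ?Z (region p)"
  proof (cases "p = []")
    case True
    then show ?thesis
      using openin_topspace[of ?Z] by (simp add: region_def top)
  next
    case False
    then show ?thesis
      using p by (simp add: region_def partial_play_def game_position_def last_conv_nth)
  qed
  have V: "openin ?Z V"
    unfolding V_def using T(1,2) by (intro openin_Int reg openin_baire_one_box) auto
  have sub: "p \<noteq> [] \<Longrightarrow> V \<subseteq> last p"
    by (simp add: V_def region_def)
  define W where "W = \<sigma> (p @ [V])"
  have W: "partial_play ?Z \<sigma> (p @ [V, W])" "openin ?Z W" "W \<noteq> {}"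
    using partial_play_extend[OF \<sigma> p V ne sub] unfolding W_def by blast+
  obtain L where "pins L W"
    using open_set_pinned[OF W(2,3)] by blast
  then have "pins L (region (p @ [V, W]))"
    by (simp add: region_def)
  moreover have "\<forall>h\<in>V. \<forall>y\<in>T. t < h y"
    by (simp add: V_def)
  ultimately show ?thesis
    using W(1) by blast
qed

text \<open>
  A state of the two simultaneous games consists of the positions \<open>p\<close> and \<open>p'\<close>, of finite sets \<open>K\<close>
  and \<open>K'\<close> that pin their regions, and of the finite set \<open>L\<close> of points that have already received
  large values in one of the games. Points of \<open>K\<close> can no longer be made large in the first game, so
  the invariant requires that they belong to \<open>L\<close>. In a round, player I first makes the points
  of \<open>K'\<close> large in the first game, whereupon they belong to the new \<open>L\<close>. Player II answers with
  a region pinned by \<open>M\<close>, and player I makes the points of \<open>M\<close> outside \<open>K'\<close> large in the second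
  game. Thus \<open>M\<close> is contained in the new \<open>L\<close>, and the invariant holds again.
\<close>

lemma not_choquet_real: "\<not> choquet_space (baire_one_space X euclideanreal)"
proof
  let ?Z = "baire_one_space X euclideanreal"
  assume "choquet_space ?Z"
  then obtain \<sigma> where win: "winning_strategy_II ?Z \<sigma>"
    unfolding choquet_space_def by blast
  then have \<sigma>: "strategy_II ?Z \<sigma>"
    by (simp add: winning_strategy_II_def)
  define P where "P = (\<lambda>(p, p', K, K', L).
    partial_play ?Z \<sigma> p \<and> partial_play ?Z \<sigma> p' \<and> pins K (region p) \<and> pins K' (region p') \<and>
    finite L \<and> K \<subseteq> L)"
  define Q where "Q = (\<lambda>(n :: nat) (p, p', K :: (real \<Rightarrow> real) set, K' :: (real \<Rightarrow> real) set, L)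
      (r, r', M :: (real \<Rightarrow> real) set, M' :: (real \<Rightarrow> real) set, N).
    (\<exists>V W. r = p @ [V, W]) \<and> (\<exists>V W. r' = p' @ [V, W]) \<and> dpt n \<in> N \<and>
    (\<forall>y\<in>N - L. \<exists>U\<in>set r \<union> set r'. \<forall>h\<in>U. real n < h y))"
  have step: "\<exists>u. P u \<and> Q n s u" if s: "P s" for s n
  proof -
    obtain p p' K K' L where s_eq: "s = (p, p', K, K', L)" by (cases s)
    have p: "partial_play ?Z \<sigma> p" "partial_play ?Z \<sigma> p'" and pin: "pins K (region p)" "pins K' (region p')"
      and L: "finite L" "K \<subseteq> L"
      using s by (simp_all add: P_def s_eq)
    define T where "T = insert (dpt n) K' - K"
    have T: "finite T" "T \<subseteq> pts" "T \<inter> K = {}"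
      using pin(2) by (auto simp: T_def pins_def)
    obtain V W M where V: "partial_play ?Z \<sigma> (p @ [V, W])" "\<forall>h\<in>V. \<forall>y\<in>T. real n < h y"
      and M: "pins M (region (p @ [V, W]))"
      using push_values_up[OF \<sigma> p(1) pin(1) T, of "real n"] by (elim exE conjE)
    define T' where "T' = M - K'"
    have T': "finite T'" "T' \<subseteq> pts" "T' \<inter> K' = {}"
      using M by (auto simp: T'_def pins_def)
    obtain V' W' M' where V': "partial_play ?Z \<sigma> (p' @ [V', W'])" "\<forall>h\<in>V'. \<forall>y\<in>T'. real n < h y"
      and M': "pins M' (region (p' @ [V', W']))"
      using push_values_up[OF \<sigma> p(2) pin(2) T', of "real n"] by (elim exE conjE)
    define N where "N = insert (dpt n) (L \<union> K' \<union> M)"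
    have new: "\<exists>U\<in>set (p @ [V, W]) \<union> set (p' @ [V', W']). \<forall>h\<in>U. real n < h y"
      if y: "y \<in> N - L" for y
    proof (cases "y \<in> T")
      case True
      then show ?thesis using V(2) by (intro bexI[of _ V]) auto
    next
      case False
      then have "y \<in> T'"
        using y L(2) by (auto simp: N_def T_def T'_def)
      then show ?thesis using V'(2) by (intro bexI[of _ V']) auto
    qed
    have "finite N"
      using L(1) pin(2) M by (simp add: N_def pins_def)
    then have "P (p @ [V, W], p' @ [V', W'], M, M', N)"
      using V(1) V'(1) M M' by (auto simp: P_def N_def)
    moreover have "Q n s (p @ [V, W], p' @ [V', W'], M, M', N)"
      unfolding Q_def s_eq prod.case
      by (intro conjI ballI new) (blast | simp add: N_def)+
    ultimately show ?thesis by blast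
  qed
  have start: "P ([], [], {}, {}, {})"
    by (simp add: P_def partial_play_def game_position_def pins_def region_def)
  define s where "s = rec_nat ([], [], {}, {}, {}) (\<lambda>n t. SOME u. P u \<and> Q n t u)"
  have s0: "s 0 = ([], [], {}, {}, {})" and sSuc: "s (Suc n) = (SOME u. P u \<and> Q n (s n) u)" for n
    by (simp_all add: s_def)
  have Ps: "P (s n)" for n
  proof (induction n)
    case 0
    then show ?case using start by (simp add: s0)
  next
    case (Suc n)
    show ?case unfolding sSuc using someI_ex[OF step[OF Suc, of n]] by (rule conjunct1)
  qed
  have Qs: "Q n (s n) (s (Suc n))" for n
    unfolding sSuc using someI_ex[OF step[OF Ps[of n], of n]] by (rule conjunct2)
  define p where "p = (\<lambda>n. fst (s n))"
  define p' where "p' = (\<lambda>n. fst (snd (s n)))"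
  define L where "L = (\<lambda>n. snd (snd (snd (snd (s n)))))"
  have p0: "p 0 = []" "p' 0 = []" "L 0 = {}"
    by (simp_all add: p_def p'_def L_def s0)
  have pp: "partial_play ?Z \<sigma> (p n)" "partial_play ?Z \<sigma> (p' n)" "finite (L n)" for n
    using Ps[of n] by (simp_all add: P_def p_def p'_def L_def case_prod_unfold)
  have ps: "\<exists>V W. p (Suc n) = p n @ [V, W]" "\<exists>V W. p' (Suc n) = p' n @ [V, W]" "dpt n \<in> L (Suc n)"
    and large: "y \<in> L (Suc n) - L n \<Longrightarrow> \<exists>U\<in>set (p (Suc n)) \<union> set (p' (Suc n)). \<forall>h\<in>U. real n < h y" for n y
    using Qs[of n] unfolding Q_def p_def p'_def L_def case_prod_unfold by blast+
  obtain h where h: "\<forall>n. \<forall>U\<in>set (p n). h \<in> U"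
    using winning_strategy_limit[of ?Z \<sigma> p, OF win p0(1) pp(1) ps(1)] by (elim exE)
  obtain h' where h': "\<forall>n. \<forall>U\<in>set (p' n). h' \<in> U"
    using winning_strategy_limit[of ?Z \<sigma> p', OF win p0(2) pp(2) ps(2)] by (elim exE)
  have mem: "z \<in> \<B>" if "partial_play ?Z \<sigma> r" "r \<noteq> []" "\<forall>U\<in>set r. z \<in> U" for r z
  proof -
    have "openin ?Z (last r)"
      using that(1,2) by (simp add: partial_play_def game_position_def last_conv_nth)
    then show ?thesis
      using that(2,3) openin_subset topspace_baire_one_space by (metis last_in_set subsetD)
  qed
  have "p (Suc 0) \<noteq> []" "p' (Suc 0) \<noteq> []"
    using ps(1,2)[of 0] by auto
  then have hB: "h \<in> \<B>" "h' \<in> \<B>"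
    using mem[OF pp(1)] mem[OF pp(2)] h h' by blast+
  obtain F where F: "\<forall>n. continuous_map X euclideanreal (F n)"
    "\<forall>y\<in>topspace X. limitin euclideanreal (\<lambda>n. F n y) (h y) sequentially"
    using hB(1) unfolding baire_one_functions_def by blast
  obtain F' where F': "\<forall>n. continuous_map X euclideanreal (F' n)"
    "\<forall>y\<in>topspace X. limitin euclideanreal (\<lambda>n. F' n y) (h' y) sequentially"
    using hB(2) unfolding baire_one_functions_def by blast
  have cont: "continuous_on pts (\<lambda>y. max (F n y) (F' n y))" for n
    using F(1) F'(1) by (intro continuous_on_max) simp_all
  have lim: "(\<lambda>n. max (F n y) (F' n y)) \<longlonglongrightarrow> max (h y) (h' y)" if "y \<in> pts" for y
    using F(2) F'(2) that by (intro tendsto_max) simp_all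
  have "\<exists>m :: nat. infinite {k. \<bar>max (h (dpt k)) (h' (dpt k))\<bar> \<le> real m}"
    by (rule baire_one_not_divergent[of "\<lambda>n y. max (F n y) (F' n y)" "\<lambda>y. max (h y) (h' y)"])
      (rule cont, erule lim)
  then obtain m :: nat where m: "infinite {k. \<bar>max (h (dpt k)) (h' (dpt k))\<bar> \<le> real m}"
    by blast
  \<comment> \<open>A point that enters \<open>L\<close> at stage \<open>i + 1\<close> has a value above \<open>i\<close> in one of the games, so
    only the points that have entered by stage \<open>m\<close> can have both values at most \<open>m\<close>.\<close>
  have "{k. \<bar>max (h (dpt k)) (h' (dpt k))\<bar> \<le> real m} \<subseteq> {k. dpt k \<in> (\<Union>n\<le>m. L n)}"
  proof
    fix k assume k: "k \<in> {k. \<bar>max (h (dpt k)) (h' (dpt k))\<bar> \<le> real m}"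
    define j where "j = (LEAST n. dpt k \<in> L n)"
    have j: "dpt k \<in> L j"
      unfolding j_def using ps(3) by (rule LeastI)
    then obtain i where i: "j = Suc i"
      using p0(3) by (cases j) auto
    then have "dpt k \<notin> L i"
      unfolding j_def by (metis lessI not_less_Least)
    then obtain U where U: "U \<in> set (p (Suc i)) \<union> set (p' (Suc i))" "\<forall>h\<in>U. real i < h (dpt k)"
      using large[of "dpt k" i] j i by blast
    then have "real i < max (h (dpt k)) (h' (dpt k))"
      using h h' by (auto simp: less_max_iff_disj)
    then have "j \<le> m"
      using k i by auto
    then show "k \<in> {k. dpt k \<in> (\<Union>n\<le>m. L n)}"
      using j by blast
  qed
  moreover have "finite {k. dpt k \<in> (\<Union>n\<le>m. L n)}"
    using pp(3) inj_dpt finite_vimageI[of "\<Union>n\<le>m. L n" dpt] by (simp add: vimage_def)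
  ultimately show False
    using m finite_subset by blast
qed

end

theorem corollary3p3:
  shows "\<exists>X :: (real \<Rightarrow> real) topology.
           completely_regular_space X \<and> Hausdorff_space X \<and>
           separable_space X \<and> pseudocompact_space X \<and>
           choquet_space (baire_one_space X (top_of_set {0..1::real})) \<and>
           \<not> choquet_space (baire_one_space X euclideanreal)"
proof -
  obtain d x null where "saturated_incidence d x null"
    using saturated_incidence_exists by (elim exE)
  then interpret saturated_incidence d x null .
  show ?thesis
    by (intro exI[of _ "top_of_set pts"] conjI completely_regular_X Hausdorff_X separable_X
        pseudocompact_X choquet_unit_interval not_choquet_real)
qed

end
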